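(* An infinite-dimensional Banach space is universally separably injective if and only if it is $\ell_\infty$-upper-saturated.
   Context: "Operator" means bounded linear map; "subspace" means closed linear subspace. A Banach space $E$ is universally separably injective if for every Banach space $X$ and each separable subspace $Y\subset X$, every operator $t:Y\to E$ extends to an operator $T:X\to E$. A Banach space $X$ is $\ell_\infty$-upper-saturated if every separable subspace of $X$ is contained in some subspace of $X$ that is (linearly) isomorphic to $\ell_\infty$. *)

theory Defs
  imports "HOL-Analysis.Analysis"
begin

text \<open>
  The Banach space \<open>E\<close> whose injectivity is studied is a type of class \<^class>\<open>banach\<close>. The
  definition of universal separable injectivity quantifies over all Banach spaces \<open>X\<close>, and HOL has
  no quantifier over types inside a formula. So a space \<open>X\<close> is given by a carrier set in
  a type \<open>'u\<close>, with its own operations and norm; these are not tied to any structure that \<open>'u\<close>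
  may have, and off the carrier they are irrelevant.
\<close>

record 'u normed_structure =
  pts :: "'u set"
  vadd :: "'u \<Rightarrow> 'u \<Rightarrow> 'u"
  vzero :: 'u
  vscale :: "real \<Rightarrow> 'u \<Rightarrow> 'u"
  vnorm :: "'u \<Rightarrow> real"

text \<open>
  The distance induced by the norm. It is set to 0 off the carrier because \<^locale>\<open>Metric_space\<close>
  requires nonnegativity and symmetry on the whole type.
\<close>

definition vnorm_dist :: "'u normed_structure \<Rightarrow> 'u \<Rightarrow> 'u \<Rightarrow> real" where
  "vnorm_dist X x y =
     (if x \<in> pts X \<and> y \<in> pts X then vnorm X (vadd X x (vscale X (- 1) y)) else 0)"

abbreviation vnorm_topology :: "'u normed_structure \<Rightarrow> 'u topology" where
  "vnorm_topology X \<equiv> Metric_space.mtopology (pts X) (vnorm_dist X)"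

locale normed_space =
  fixes X :: "'u normed_structure"
  assumes zero_in: "vzero X \<in> pts X"
    and add_in: "\<lbrakk>x \<in> pts X; y \<in> pts X\<rbrakk> \<Longrightarrow> vadd X x y \<in> pts X"
    and scale_in: "x \<in> pts X \<Longrightarrow> vscale X c x \<in> pts X"
    and add_assoc: "\<lbrakk>x \<in> pts X; y \<in> pts X; z \<in> pts X\<rbrakk>
                      \<Longrightarrow> vadd X (vadd X x y) z = vadd X x (vadd X y z)"
    and add_commute: "\<lbrakk>x \<in> pts X; y \<in> pts X\<rbrakk> \<Longrightarrow> vadd X x y = vadd X y x"
    and add_zero: "x \<in> pts X \<Longrightarrow> vadd X x (vzero X) = x"
    and add_inverse: "x \<in> pts X \<Longrightarrow> \<exists>y\<in>pts X. vadd X x y = vzero X"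
    and scale_add: "\<lbrakk>x \<in> pts X; y \<in> pts X\<rbrakk>
                      \<Longrightarrow> vscale X c (vadd X x y) = vadd X (vscale X c x) (vscale X c y)"
    and add_scale: "x \<in> pts X \<Longrightarrow> vscale X (c + d) x = vadd X (vscale X c x) (vscale X d x)"
    and scale_scale: "x \<in> pts X \<Longrightarrow> vscale X c (vscale X d x) = vscale X (c * d) x"
    and scale_one: "x \<in> pts X \<Longrightarrow> vscale X 1 x = x"
    and vnorm_eq_zero_iff: "x \<in> pts X \<Longrightarrow> vnorm X x = 0 \<longleftrightarrow> x = vzero X"
    and vnorm_scale: "x \<in> pts X \<Longrightarrow> vnorm X (vscale X c x) = \<bar>c\<bar> * vnorm X x"
    and vnorm_triangle: "\<lbrakk>x \<in> pts X; y \<in> pts X\<rbrakk> \<Longrightarrow> vnorm X (vadd X x y) \<le> vnorm X x + vnorm X y"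

locale banach_space = normed_space +
  assumes complete: "Metric_space.mcomplete (pts X) (vnorm_dist X)"

context normed_space
begin

lemma scale_zero_left: assumes x: "x \<in> pts X" shows "vscale X 0 x = vzero X"
proof -
  let ?z = "vscale X 0 x"
  have z: "?z \<in> pts X" by (rule scale_in[OF x])
  obtain y where y: "y \<in> pts X" "vadd X ?z y = vzero X" using add_inverse[OF z] by blast
  have "?z = vadd X ?z ?z" using add_scale[OF x, of 0 0] by simp
  then have "vadd X ?z y = vadd X (vadd X ?z ?z) y" by simp
  also have "\<dots> = ?z" using add_assoc[OF z z y(1)] y(2) add_zero[OF z] by simp
  finally show ?thesis using y(2) by simp
qed

lemma add_uminus: "x \<in> pts X \<Longrightarrow> vadd X x (vscale X (- 1) x) = vzero X"
  using add_scale[of x 1 "- 1"] scale_one[of x] scale_zero_left[of x] by simp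

lemma vnorm_nonneg: assumes x: "x \<in> pts X" shows "0 \<le> vnorm X x"
proof -
  have "vnorm X (vzero X) = 0" using vnorm_eq_zero_iff[OF zero_in] by simp
  then show ?thesis
    using vnorm_triangle[OF x scale_in[OF x, of "- 1"]] vnorm_scale[OF x, of "- 1"] add_uminus[OF x]
    by simp
qed

lemma vnorm_dist_commute:
  assumes x: "x \<in> pts X" and y: "y \<in> pts X"
  shows "vnorm_dist X x y = vnorm_dist X y x"
proof -
  note m = scale_in[OF x, of "- 1"] scale_in[OF y, of "- 1"]
  have "vscale X (- 1) (vadd X x (vscale X (- 1) y)) = vadd X y (vscale X (- 1) x)"
    using scale_add[OF x m(2), of "- 1"] scale_scale[OF y, of "- 1" "- 1"] scale_one[OF y]
      add_commute[OF m(1) y] by simp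
  then show ?thesis
    using vnorm_scale[OF add_in[OF x m(2)], of "- 1"] by (simp add: vnorm_dist_def)
qed

lemma vnorm_dist_eq_0:
  assumes x: "x \<in> pts X" and y: "y \<in> pts X"
  shows "vnorm_dist X x y = 0 \<longleftrightarrow> x = y"
proof
  assume "vnorm_dist X x y = 0"
  note m = scale_in[OF y, of "- 1"]
  have "vadd X x (vscale X (- 1) y) = vzero X"
    using \<open>vnorm_dist X x y = 0\<close> vnorm_eq_zero_iff[OF add_in[OF x m]] x y by (simp add: vnorm_dist_def)
  then have "vadd X (vzero X) y = vadd X x (vadd X (vscale X (- 1) y) y)"
    using add_assoc[OF x m y] by simp
  then show "x = y"
    using add_commute[OF m y] add_uminus[OF y] add_zero[OF x] add_zero[OF y]
      add_commute[OF zero_in y] by simp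
next
  assume "x = y"
  then show "vnorm_dist X x y = 0"
    using add_uminus[OF x] vnorm_eq_zero_iff[OF zero_in] by (simp add: vnorm_dist_def)
qed

lemma vnorm_dist_triangle:
  assumes x: "x \<in> pts X" and y: "y \<in> pts X" and z: "z \<in> pts X"
  shows "vnorm_dist X x z \<le> vnorm_dist X x y + vnorm_dist X y z"
proof -
  note my = scale_in[OF y, of "- 1"]
  note mz = scale_in[OF z, of "- 1"]
  have "vadd X (vscale X (- 1) y) (vadd X y (vscale X (- 1) z))
      = vadd X (vadd X (vscale X (- 1) y) y) (vscale X (- 1) z)"
    using add_assoc[OF my y mz] by simp
  also have "\<dots> = vscale X (- 1) z"
    using add_commute[OF my y] add_uminus[OF y] add_commute[OF zero_in mz] add_zero[OF mz] by simp
  finally have "vadd X (vadd X x (vscale X (- 1) y)) (vadd X y (vscale X (- 1) z))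
      = vadd X x (vscale X (- 1) z)"
    using add_assoc[OF x my add_in[OF y mz]] by simp
  then show ?thesis
    using vnorm_triangle[OF add_in[OF x my] add_in[OF y mz]] x y z by (simp add: vnorm_dist_def)
qed

lemma Metric_space_vnorm_dist: "Metric_space (pts X) (vnorm_dist X)"
proof
  show "0 \<le> vnorm_dist X x y" for x y
    using vnorm_nonneg[OF add_in[OF _ scale_in]] by (simp add: vnorm_dist_def)
  show "vnorm_dist X x y = vnorm_dist X y x" for x y
    using vnorm_dist_commute[of x y] by (cases "x \<in> pts X \<and> y \<in> pts X") (auto simp: vnorm_dist_def)
qed (simp_all add: vnorm_dist_eq_0 vnorm_dist_triangle)

end

definition copy_along :: "('x::real_normed_vector \<Rightarrow> 'u) \<Rightarrow> 'u normed_structure" where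
  "copy_along f =
     \<lparr>pts = range f,
      vadd = (\<lambda>u v. f (inv f u + inv f v)),
      vzero = f 0,
      vscale = (\<lambda>c u. f (c *\<^sub>R inv f u)),
      vnorm = (\<lambda>u. norm (inv f u))\<rparr>"

lemma banach_space_copy_along:
  fixes f :: "'x::banach \<Rightarrow> 'u"
  assumes f: "inj f"
  shows "banach_space (copy_along f)"
proof -
  let ?X = "copy_along f"
  interpret normed_space ?X
  proof
    show "\<exists>y\<in>pts ?X. vadd ?X x y = vzero ?X" if "x \<in> pts ?X" for x
      using that f by (auto simp: copy_along_def intro!: exI[of _ "- inv f x"])
  qed (use f in \<open>auto simp: copy_along_def algebra_simps inj_eq norm_triangle_ineq\<close>)
  interpret M: Metric_space "pts ?X" "vnorm_dist ?X" by (rule Metric_space_vnorm_dist)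
  have d: "vnorm_dist ?X (f x) (f y) = dist x y" for x y
    using f by (simp add: vnorm_dist_def copy_along_def dist_norm)
  have "\<exists>x. limitin M.mtopology \<sigma> x sequentially" if \<sigma>: "M.MCauchy \<sigma>" for \<sigma>
  proof -
    define s where "s n = inv f (\<sigma> n)" for n
    have "range \<sigma> \<subseteq> pts ?X" using \<sigma> unfolding M.MCauchy_def by blast
    then have "range \<sigma> \<subseteq> range f" by (simp add: copy_along_def)
    then have s: "\<sigma> n = f (s n)" for n by (simp add: s_def f_inv_into_f range_subsetD)
    have "Cauchy s"
      using \<sigma> by (simp add: M.MCauchy_def Cauchy_def s d)
    then obtain l where "s \<longlonglongrightarrow> l" using Cauchy_convergent convergent_def by blast
    then have "limitin M.mtopology \<sigma> (f l) sequentially"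
      unfolding M.limitin_metric s d tendsto_iff by (simp add: copy_along_def)
    then show ?thesis ..
  qed
  then have "M.mcomplete" by (simp add: M.mcomplete_def)
  then show ?thesis by unfold_locales
qed

definition closed_subspace_of :: "'u normed_structure \<Rightarrow> 'u set \<Rightarrow> bool" where
  "closed_subspace_of X Y \<longleftrightarrow>
     vzero X \<in> Y \<and>
     (\<forall>x\<in>Y. \<forall>y\<in>Y. vadd X x y \<in> Y) \<and>
     (\<forall>c. \<forall>x\<in>Y. vscale X c x \<in> Y) \<and>
     closedin (vnorm_topology X) Y"

definition bounded_operator_on ::
    "'u normed_structure \<Rightarrow> 'u set \<Rightarrow> ('u \<Rightarrow> 'a::real_normed_vector) \<Rightarrow> bool" where
  "bounded_operator_on X Y t \<longleftrightarrow>
     (\<forall>x\<in>Y. \<forall>y\<in>Y. t (vadd X x y) = t x + t y) \<and>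
     (\<forall>c. \<forall>x\<in>Y. t (vscale X c x) = c *\<^sub>R t x) \<and>
     (\<exists>K. \<forall>x\<in>Y. norm (t x) \<le> K * vnorm X x)"

text \<open>
  The type argument \<open>'u\<close> bounds the size of the test spaces \<open>X\<close>: all Banach spaces carried by subsets
  of \<open>'u\<close> are considered. Up to isometry, every Banach space is covered when \<open>'u\<close> varies. A result that
  derives properties of \<open>E\<close> from this notion needs \<open>'u\<close> to be large enough, and should
  therefore use it for a type such as \<^typ>\<open>'a + 'u\<close>, which contains a copy of \<open>E\<close> for every \<open>'u\<close>.
\<close>

definition universally_separably_injective :: "'u itself \<Rightarrow> 'a::banach itself \<Rightarrow> bool" where
  "universally_separably_injective _ _ \<longleftrightarrow>
     (\<forall>(X :: 'u normed_structure) Y (t :: 'u \<Rightarrow> 'a).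
        banach_space X \<and> closed_subspace_of X Y \<and>
        separable_space (subtopology (vnorm_topology X) Y) \<and>
        bounded_operator_on X Y t \<longrightarrow>
        (\<exists>T :: 'u \<Rightarrow> 'a. bounded_operator_on X (pts X) T \<and> (\<forall>y\<in>Y. T y = t y)))"

text \<open>
  Since \<^typ>\<open>nat\<close> carries the discrete topology, the bounded continuous functions
  \<^typ>\<open>nat \<Rightarrow>\<^sub>C real\<close> with the supremum norm are the space \<open>\<ell>\<^sub>\<infinity>\<close>.
\<close>

type_synonym linfty = "nat \<Rightarrow>\<^sub>C real"

definition isomorphic_to_linfty :: "'a::real_normed_vector set \<Rightarrow> bool" where
  "isomorphic_to_linfty Z \<longleftrightarrow>
     (\<exists>(f :: linfty \<Rightarrow> 'a) g. linear f \<and> homeomorphism UNIV Z f g)"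

definition linfty_upper_saturated :: "'a::banach itself \<Rightarrow> bool" where
  "linfty_upper_saturated _ \<longleftrightarrow>
     (\<forall>Y :: 'a set. subspace Y \<and> closed Y \<and> separable_space (top_of_set Y) \<longrightarrow>
        (\<exists>Z. subspace Z \<and> closed Z \<and> Y \<subseteq> Z \<and> isomorphic_to_linfty Z))"

definition infinite_dimensional :: "'a::real_vector itself \<Rightarrow> bool" where
  "infinite_dimensional _ \<longleftrightarrow> \<not> (\<exists>B :: 'a set. finite B \<and> span B = UNIV)"

end

theory Submission
  imports Defs
begin

text \<open>
  For sufficiency, the closed range of an operator on a separable subspace lies in a copy of
  \<open>\<ell>\<^sub>\<infinity>\<close>, where the Hahn-Banach theorem extends it coordinate by coordinate.

  For necessity, let \<open>Y\<close> be a separable subspace of the injective space \<open>E\<close>. Norming functionals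
  give \<open>i : E \<rightarrow> \<ell>\<^sub>\<infinity>\<close>, isomorphic on \<open>Y\<close>, and injectivity gives \<open>v : \<ell>\<^sub>\<infinity> \<rightarrow> E\<close> with \<open>v i = 1\<close> on \<open>Y\<close>.
  Suppose that there are \<open>w : \<ell>\<^sub>\<infinity> \<rightarrow> E\<close> and \<open>r : E \<rightarrow> \<ell>\<^sub>\<infinity>\<close> with \<open>r w = 1\<close> and \<open>r = 0\<close> on \<open>Y\<close>, and put
  \<open>u = v - w r v\<close>. Then \<open>T = u + w (1 - i u)\<close> has the left inverse \<open>r + i (1 - w r)\<close>, and \<open>T i = 1\<close>
  on \<open>Y\<close>; so \<open>T\<close> maps \<open>\<ell>\<^sub>\<infinity>\<close> isomorphically onto a subspace that contains \<open>Y\<close>.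

  To find \<open>w\<close> and \<open>r\<close>, apply the first step to an infinite-dimensional separable \<open>Y\<close>. If \<open>v\<close> sent every
  bounded disjoint sequence to a null sequence, it would be controlled by a positive functional, and
  the supremum norm on \<open>i Y\<close> would be dominated by an \<open>L\<^sub>1\<close>-norm; by an argument of Grothendieck this
  forces \<open>i Y\<close> to be finite-dimensional. So there is \<open>J : \<ell>\<^sub>\<infinity> \<rightarrow> E\<close> with \<open>\<parallel>J e\<^sub>k\<parallel> \<ge> \<delta>\<close> for all \<open>k\<close>, and by
  Rosenthal's lemma \<open>J\<close> fixes a copy of \<open>\<ell>\<^sub>\<infinity>\<close>. Each infinite set has uncountably many subsets, hence one
  whose indicator is mapped far away from \<open>Y\<close>; disjoint such indicators, functionals that separate
  their images from \<open>Y\<close>, and a second use of Rosenthal's lemma give \<open>w\<close> and \<open>r\<close>.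
\<close>

section \<open>The Hahn-Banach theorem\<close>

text \<open>Homogeneity is asked only as an inequality for \<open>c > 0\<close>. Using it for
  \<open>1 / c\<close> too gives equality; \<open>c = 1/2\<close> and subadditivity give the value 0
  at the zero vector.\<close>

definition sublinear_on :: "'u normed_structure \<Rightarrow> ('u \<Rightarrow> real) \<Rightarrow> bool" where
  "sublinear_on X q \<longleftrightarrow>
     (\<forall>x\<in>pts X. \<forall>y\<in>pts X. q (vadd X x y) \<le> q x + q y) \<and>
     (\<forall>c>0. \<forall>x\<in>pts X. q (vscale X c x) \<le> c * q x)"

lemma sublinear_onD:
  assumes "sublinear_on X q" "x \<in> pts X"
  shows "y \<in> pts X \<Longrightarrow> q (vadd X x y) \<le> q x + q y"
    and "c > 0 \<Longrightarrow> q (vscale X c x) \<le> c * q x"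
  using assms by (auto simp: sublinear_on_def)

context normed_space
begin

lemma vscale_zero_right [simp]: "vscale X c (vzero X) = vzero X"
  using scale_scale[OF zero_in, of c 0] scale_zero_left[OF zero_in] by simp

lemma vadd_left_commute:
  assumes "x \<in> pts X" "y \<in> pts X" "z \<in> pts X"
  shows "vadd X x (vadd X y z) = vadd X y (vadd X x z)"
  by (metis assms add_assoc add_commute)

lemma vadd_vadd_swap:
  assumes "x \<in> pts X" "y \<in> pts X" "z \<in> pts X" "w \<in> pts X"
  shows "vadd X (vadd X x y) (vadd X z w) = vadd X (vadd X x z) (vadd X y w)"
  by (metis assms add_assoc add_in vadd_left_commute)

lemma vadd_uminus_cancel:
  assumes "x \<in> pts X" "y \<in> pts X"
  shows "vadd X (vadd X x y) (vscale X (- 1) x) = y"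
  by (metis assms add_assoc add_commute add_uminus add_zero scale_in)

lemma sublinear_on_zero:
  assumes "sublinear_on X q" shows "q (vzero X) = 0"
  using sublinear_onD(1)[OF assms zero_in zero_in] sublinear_onD(2)[OF assms zero_in, of "1/2"]
  by (simp add: add_zero[OF zero_in])

lemma sublinear_on_ge:
  assumes "sublinear_on X q" and x: "x \<in> pts X" shows "- q (vscale X (- 1) x) \<le> q x"
  using sublinear_onD(1)[OF assms scale_in[OF x, of "- 1"]] sublinear_on_zero[OF assms(1)]
  by (simp add: add_uminus[OF x])

lemma sublinear_on_scale:
  assumes q: "sublinear_on X q" and x: "x \<in> pts X" and c: "c \<ge> 0"
  shows "q (vscale X c x) = c * q x"
proof (cases "c = 0")
  case True
  then show ?thesis by (simp add: scale_zero_left[OF x] sublinear_on_zero[OF q])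
next
  case False
  with c have c: "c > 0" by simp
  have "q (vscale X (1 / c) (vscale X c x)) \<le> 1 / c * q (vscale X c x)"
    by (rule sublinear_onD(2)[OF q scale_in[OF x]]) (use c in simp)
  then have "q x \<le> q (vscale X c x) / c"
    using c by (simp add: scale_scale[OF x] scale_one[OF x])
  then have "c * q x \<le> q (vscale X c x)" using c by (simp add: field_simps)
  then show ?thesis using sublinear_onD(2)[OF q x c] by simp
qed

text \<open>The infimal convolution of \<open>q\<close> and \<open>g\<close> over the cone does
  this: \<open>g \<le> q\<close> on \<open>C\<close> bounds it below by \<open>- q (- x)\<close>,
  the term of the zero vector gives \<open>q' \<le> q\<close>, and at \<open>- y\<close> the term of
  \<open>y\<close> is \<open>- g y\<close>. A linear functional below \<open>q'\<close> then
  dominates \<open>g\<close> on \<open>C\<close>.\<close>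

lemma sublinear_on_cone_minorant:
  assumes q: "sublinear_on X q"
    and C: "C \<subseteq> pts X" "vzero X \<in> C"
      "\<And>x y. \<lbrakk>x \<in> C; y \<in> C\<rbrakk> \<Longrightarrow> vadd X x y \<in> C"
      "\<And>c x. \<lbrakk>c > 0; x \<in> C\<rbrakk> \<Longrightarrow> vscale X c x \<in> C"
    and g_add: "\<And>x y. \<lbrakk>x \<in> C; y \<in> C\<rbrakk> \<Longrightarrow> g (vadd X x y) = g x + g y"
    and g_scale: "\<And>c x. \<lbrakk>c > 0; x \<in> C\<rbrakk> \<Longrightarrow> g (vscale X c x) = c * g x"
    and g_le: "\<And>x. x \<in> C \<Longrightarrow> g x \<le> q x"
  obtains q' where "sublinear_on X q'" "\<And>x. x \<in> pts X \<Longrightarrow> q' x \<le> q x"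
    "\<And>y. y \<in> C \<Longrightarrow> q' (vscale X (- 1) y) \<le> - g y" "\<And>x. x \<notin> pts X \<Longrightarrow> q' x = 0"
proof -
  \<comment> \<open>The value 0 off the carrier makes functionals that agree on \<open>pts X\<close>
    equal; minimality is later stated as such an equality.\<close>
  define q' where "q' x = (if x \<in> pts X then INF y\<in>C. q (vadd X x y) - g y else 0)" for x
  have Cp: "y \<in> C \<Longrightarrow> y \<in> pts X" for y using C(1) by blast
  have g0: "g (vzero X) = 0"
    using g_add[OF C(2) C(2)] by (simp add: add_zero[OF zero_in])
  have bdd: "bdd_below ((\<lambda>y. q (vadd X x y) - g y) ` C)" if x: "x \<in> pts X" for x
  proof (rule bdd_belowI2)
    fix y assume y: "y \<in> C"
    have "q y \<le> q (vadd X x y) + q (vscale X (- 1) x)"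
      using sublinear_onD(1)[OF q add_in[OF x Cp[OF y]] scale_in[OF x, of "- 1"]]
      by (simp add: vadd_uminus_cancel[OF x Cp[OF y]])
    then show "- q (vscale X (- 1) x) \<le> q (vadd X x y) - g y"
      using g_le[OF y] by simp
  qed
  have upper: "q' x \<le> q (vadd X x y) - g y" if "x \<in> pts X" "y \<in> C" for x y
    using cINF_lower[OF bdd that(2)] that by (simp add: q'_def)
  have greatest: "m \<le> q' x" if "x \<in> pts X" "\<And>y. y \<in> C \<Longrightarrow> m \<le> q (vadd X x y) - g y" for x m
    using cINF_greatest[of C m "\<lambda>y. q (vadd X x y) - g y"] C(2) that by (auto simp: q'_def)
  have "sublinear_on X q'"
    unfolding sublinear_on_def
  proof (intro conjI ballI allI impI)
    fix x y assume x: "x \<in> pts X" and y: "y \<in> pts X"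
    \<comment> \<open>Keep \<open>z\<close> fixed and take the infimum over \<open>w\<close> first;
      the infimum over \<open>z\<close> follows.\<close>
    have "q' (vadd X x y) - (q (vadd X x z) - g z) \<le> q' y" if z: "z \<in> C" for z
    proof (rule greatest[OF y])
      fix w assume w: "w \<in> C"
      have "q' (vadd X x y) \<le> q (vadd X (vadd X x y) (vadd X z w)) - g (vadd X z w)"
        by (rule upper[OF add_in[OF x y] C(3)[OF z w]])
      also have "vadd X (vadd X x y) (vadd X z w) = vadd X (vadd X x z) (vadd X y w)"
        by (rule vadd_vadd_swap[OF x y Cp[OF z] Cp[OF w]])
      also have "q \<dots> \<le> q (vadd X x z) + q (vadd X y w)"
        by (rule sublinear_onD(1)[OF q add_in[OF x Cp[OF z]] add_in[OF y Cp[OF w]]])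
      finally show "q' (vadd X x y) - (q (vadd X x z) - g z) \<le> q (vadd X y w) - g w"
        using g_add[OF z w] by simp
    qed
    then have "q' (vadd X x y) - q' y \<le> q (vadd X x z) - g z" if z: "z \<in> C" for z
      using that by (auto simp: algebra_simps)
    from greatest[OF x this] show "q' (vadd X x y) \<le> q' x + q' y" by simp
  next
    fix c x assume c: "(c::real) > 0" and x: "x \<in> pts X"
    have "q' (vscale X c x) / c \<le> q' x"
    proof (rule greatest[OF x])
      fix y assume y: "y \<in> C"
      have "q' (vscale X c x) \<le> q (vadd X (vscale X c x) (vscale X c y)) - g (vscale X c y)"
        by (rule upper[OF scale_in[OF x] C(4)[OF c y]])
      also have "\<dots> \<le> c * (q (vadd X x y) - g y)"
        using sublinear_onD(2)[OF q add_in[OF x Cp[OF y]] c] g_scale[OF c y]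
        by (simp add: scale_add[OF x Cp[OF y]] algebra_simps)
      finally show "q' (vscale X c x) / c \<le> q (vadd X x y) - g y"
        using c by (simp add: field_simps)
    qed
    then show "q' (vscale X c x) \<le> c * q' x" using c by (simp add: field_simps)
  qed
  moreover have "q' x \<le> q x" if "x \<in> pts X" for x
    using upper[OF that C(2)] by (simp add: add_zero[OF that] g0)
  moreover have "q' (vscale X (- 1) y) \<le> - g y" if y: "y \<in> C" for y
    using upper[OF scale_in[OF Cp[OF y]] y, of "- 1"] sublinear_on_zero[OF q]
    by (simp add: add_commute[OF scale_in[OF Cp[OF y], of "- 1"] Cp[OF y]] add_uminus[OF Cp[OF y]])
  moreover have "q' x = 0" if "x \<notin> pts X" for x
    using that by (simp add: q'_def)
  ultimately show thesis by (rule that)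
qed

text \<open>Zorn's lemma for the reversed order. A chain is bounded by its pointwise infimum, which
  is finite because each member is at least \<open>- q0 (- x)\<close> at \<open>x\<close>.\<close>

lemma minimal_sublinear_on:
  assumes q0: "sublinear_on X q0" "\<And>x. x \<notin> pts X \<Longrightarrow> q0 x = 0"
  obtains m where "sublinear_on X m" "\<And>x. x \<notin> pts X \<Longrightarrow> m x = 0" "m \<le> q0"
    "\<And>q. \<lbrakk>sublinear_on X q; \<And>x. x \<notin> pts X \<Longrightarrow> q x = 0; q \<le> m\<rbrakk> \<Longrightarrow> q = m"
proof -
  define A where "A = {q. sublinear_on X q \<and> (\<forall>x. x \<notin> pts X \<longrightarrow> q x = 0) \<and> q \<le> q0}"
  let ?P = "\<lambda>p q :: 'u \<Rightarrow> real. q \<le> p"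
  have po: "partial_order_on A (relation_of ?P A)"
    by (rule partial_order_on_relation_ofI) auto
  have ch: "\<exists>u\<in>A. \<forall>a\<in>C. ?P a u" if C: "C \<in> Chains (relation_of ?P A)" for C
  proof (cases "C = {}")
    case True
    then show ?thesis using q0 by (auto simp: A_def)
  next
    case ne: False
    have CA: "q \<in> A" if "q \<in> C" for q
      using C that by (auto simp: Chains_def relation_of_def)
    have chain: "p \<le> q \<or> q \<le> p" if "p \<in> C" "q \<in> C" for p q
      using C that by (auto simp: Chains_def relation_of_def)
    define u where "u x = (INF q\<in>C. q x)" for x
    have bdd: "bdd_below ((\<lambda>q. q x) ` C)" for x
    proof (cases "x \<in> pts X")
      case True
      have "- q0 (vscale X (- 1) x) \<le> q x" if "q \<in> C" for q
        using sublinear_on_ge[OF _ True, of q] CA[OF that]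
        by (force simp: A_def le_fun_def dest: spec[of _ "vscale X (- 1) x"])
      then show ?thesis by (rule bdd_belowI2)
    next
      case False
      then have "0 \<le> q x" if "q \<in> C" for q using CA[OF that] by (simp add: A_def)
      then show ?thesis by (rule bdd_belowI2)
    qed
    have upper: "u x \<le> q x" if "q \<in> C" for q x
      unfolding u_def by (rule cINF_lower[OF bdd that])
    have greatest: "r \<le> u x" if "\<And>q. q \<in> C \<Longrightarrow> r \<le> q x" for x r
      unfolding u_def by (rule cINF_greatest[OF ne that])
    have "sublinear_on X u"
      unfolding sublinear_on_def
    proof (intro conjI ballI allI impI)
      fix x y assume x: "x \<in> pts X" and y: "y \<in> pts X"
      \<comment> \<open>The smaller of \<open>p\<close> and \<open>q\<close> is subadditive and lies
        below both, which handles the mixed sum.\<close>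
      have "u (vadd X x y) - p x \<le> q y" if p: "p \<in> C" and q: "q \<in> C" for p q
      proof -
        obtain r where r: "r \<in> C" "r \<le> p" "r \<le> q" using chain[OF p q] p q by blast
        have "u (vadd X x y) \<le> r (vadd X x y)" by (rule upper[OF r(1)])
        also have "\<dots> \<le> r x + r y" using CA[OF r(1)] x y by (simp add: A_def sublinear_on_def)
        also have "\<dots> \<le> p x + q y" using r by (simp add: le_fun_def add_mono)
        finally show ?thesis by simp
      qed
      then have "u (vadd X x y) - p x \<le> u y" if "p \<in> C" for p
        using that by (intro greatest)
      then have "u (vadd X x y) - u y \<le> p x" if "p \<in> C" for p
        using that by (auto simp: algebra_simps)
      then have "u (vadd X x y) - u y \<le> u x" by (rule greatest)
      then show "u (vadd X x y) \<le> u x + u y" by simp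
    next
      fix c x assume c: "(c::real) > 0" and x: "x \<in> pts X"
      have "u (vscale X c x) / c \<le> q x" if q: "q \<in> C" for q
      proof -
        have "u (vscale X c x) \<le> q (vscale X c x)" by (rule upper[OF q])
        also have "\<dots> \<le> c * q x" using CA[OF q] c x by (simp add: A_def sublinear_on_def)
        finally show ?thesis using c by (simp add: field_simps)
      qed
      then have "u (vscale X c x) / c \<le> u x" by (rule greatest)
      then show "u (vscale X c x) \<le> c * u x" using c by (simp add: field_simps)
    qed
    moreover have "u x = 0" if "x \<notin> pts X" for x
    proof -
      have "(\<lambda>q. q x) ` C = {0}" using CA ne that by (force simp: A_def)
      then show ?thesis by (simp add: u_def)
    qed
    moreover obtain p where "p \<in> C" using ne by blast
    then have "u \<le> q0" using upper[OF \<open>p \<in> C\<close>] CA[OF \<open>p \<in> C\<close>]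
      by (force simp: A_def le_fun_def intro: order_trans)
    ultimately have "u \<in> A" by (simp add: A_def)
    then show ?thesis using upper by (auto simp: le_fun_def)
  qed
  obtain m where m: "m \<in> A" "\<And>q. \<lbrakk>q \<in> A; q \<le> m\<rbrakk> \<Longrightarrow> q = m"
    using predicate_Zorn[OF po ch] by blast
  show thesis
  proof (rule that)
    show "q = m" if "sublinear_on X q" "\<And>x. x \<notin> pts X \<Longrightarrow> q x = 0" "q \<le> m" for q
      using that m by (intro m(2)) (auto simp: A_def)
  qed (use m in \<open>auto simp: A_def\<close>)
qed

text \<open>On the ray \<open>C\<close> through \<open>a\<close> the functional \<open>m\<close> is
  additive, so it can serve as \<open>g\<close> in \<open>sublinear_on_cone_minorant\<close>. By
  minimality the minorant is \<open>m\<close> itself, and its bound at \<open>- a\<close> is the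
  missing inequality.\<close>

lemma minimal_sublinear_on_uminus:
  assumes m: "sublinear_on X m"
    and min: "\<And>q. \<lbrakk>sublinear_on X q; \<And>x. x \<notin> pts X \<Longrightarrow> q x = 0; q \<le> m\<rbrakk> \<Longrightarrow> q = m"
    and m0: "\<And>x. x \<notin> pts X \<Longrightarrow> m x = 0"
    and a: "a \<in> pts X"
  shows "m (vscale X (- 1) a) = - m a"
proof -
  define C where "C = (\<lambda>t. vscale X t a) ` {0..}"
  obtain q where q: "sublinear_on X q" "\<And>x. x \<in> pts X \<Longrightarrow> q x \<le> m x"
    "\<And>y. y \<in> C \<Longrightarrow> q (vscale X (- 1) y) \<le> - m y" "\<And>x. x \<notin> pts X \<Longrightarrow> q x = 0"
  proof (rule sublinear_on_cone_minorant[OF m, of C m])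
    show "C \<subseteq> pts X" by (auto simp: C_def a scale_in)
    show "vzero X \<in> C" unfolding C_def by (rule image_eqI[of _ _ 0]) (simp_all add: scale_zero_left[OF a])
    show "vadd X x y \<in> C" if "x \<in> C" "y \<in> C" for x y
      using that by (force simp: C_def add_scale[OF a, symmetric])
    show "vscale X c x \<in> C" if "c > 0" "x \<in> C" for c x
      using that by (force simp: C_def scale_scale[OF a])
    show "m (vadd X x y) = m x + m y" if "x \<in> C" "y \<in> C" for x y
    proof -
      obtain s t where st: "x = vscale X s a" "y = vscale X t a" "s \<ge> 0" "t \<ge> 0"
        using \<open>x \<in> C\<close> \<open>y \<in> C\<close> by (auto simp: C_def)
      then show ?thesis
        using sublinear_on_scale[OF m a, of "s + t"] sublinear_on_scale[OF m a, of s]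
          sublinear_on_scale[OF m a, of t] by (simp add: add_scale[OF a] algebra_simps)
    qed
    show "m (vscale X c x) = c * m x" if "c > 0" "x \<in> C" for c x
      using that sublinear_on_scale[OF m, of x c] by (auto simp: C_def a scale_in)
  qed auto
  have "q = m"
    using q m0 by (intro min) (auto simp: le_fun_def, metis order_refl)
  moreover have "a \<in> C" unfolding C_def by (rule image_eqI[of _ _ 1]) (simp_all add: scale_one[OF a])
  ultimately have "m (vscale X (- 1) a) \<le> - m a" using q(3) by blast
  then show ?thesis using sublinear_on_ge[OF m a] by simp
qed

text \<open>A minimal sublinear functional is linear, and it is enough to make the given sublinear
  functional smaller on the negatives of \<open>C\<close> before minimizing.\<close>

theorem Hahn_Banach_cone:
  assumes q: "sublinear_on X q"
    and C: "C \<subseteq> pts X" "vzero X \<in> C"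
      "\<And>x y. \<lbrakk>x \<in> C; y \<in> C\<rbrakk> \<Longrightarrow> vadd X x y \<in> C"
      "\<And>c x. \<lbrakk>c > 0; x \<in> C\<rbrakk> \<Longrightarrow> vscale X c x \<in> C"
    and g: "\<And>x y. \<lbrakk>x \<in> C; y \<in> C\<rbrakk> \<Longrightarrow> g (vadd X x y) = g x + g y"
      "\<And>c x. \<lbrakk>c > 0; x \<in> C\<rbrakk> \<Longrightarrow> g (vscale X c x) = c * g x"
      "\<And>x. x \<in> C \<Longrightarrow> g x \<le> q x"
  obtains F where "\<And>x y. \<lbrakk>x \<in> pts X; y \<in> pts X\<rbrakk> \<Longrightarrow> F (vadd X x y) = F x + F y"
    "\<And>c x. x \<in> pts X \<Longrightarrow> F (vscale X c x) = c * F x"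
    "\<And>x. x \<in> pts X \<Longrightarrow> F x \<le> q x" "\<And>x. x \<in> C \<Longrightarrow> g x \<le> F x"
proof -
  obtain q' where q': "sublinear_on X q'" "\<And>x. x \<in> pts X \<Longrightarrow> q' x \<le> q x"
    "\<And>y. y \<in> C \<Longrightarrow> q' (vscale X (- 1) y) \<le> - g y" "\<And>x. x \<notin> pts X \<Longrightarrow> q' x = 0"
    using sublinear_on_cone_minorant[OF q C g] by blast
  obtain m where m: "sublinear_on X m" "\<And>x. x \<notin> pts X \<Longrightarrow> m x = 0" "m \<le> q'"
    and min: "\<And>q. \<lbrakk>sublinear_on X q; \<And>x. x \<notin> pts X \<Longrightarrow> q x = 0; q \<le> m\<rbrakk> \<Longrightarrow> q = m"
    using minimal_sublinear_on[OF q'(1,4)] by blast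
  have neg: "m (vscale X (- 1) x) = - m x" if "x \<in> pts X" for x
    by (rule minimal_sublinear_on_uminus[OF m(1) min m(2) that])
  have scale: "m (vscale X c x) = c * m x" if x: "x \<in> pts X" for c x
  proof (cases "c \<ge> 0")
    case True
    then show ?thesis by (rule sublinear_on_scale[OF m(1) x])
  next
    case False
    then have "m (vscale X (- c) x) = - c * m x" by (intro sublinear_on_scale[OF m(1) x]) simp
    then show ?thesis using neg[OF scale_in[OF x, of "- c"]] by (simp add: scale_scale[OF x])
  qed
  show thesis
  proof (rule that[of m])
    fix x y assume x: "x \<in> pts X" and y: "y \<in> pts X"
    have "m (vscale X (- 1) (vadd X x y)) \<le> m (vscale X (- 1) x) + m (vscale X (- 1) y)"
      unfolding scale_add[OF x y] by (rule sublinear_onD(1)[OF m(1) scale_in[OF x] scale_in[OF y]])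
    then show "m (vadd X x y) = m x + m y"
      using neg[OF add_in[OF x y]] neg[OF x] neg[OF y] sublinear_onD(1)[OF m(1) x y] by simp
  next
    fix x assume x: "x \<in> pts X"
    show "m x \<le> q x" using m(3) q'(2)[OF x] by (force simp: le_fun_def intro: order_trans)
  next
    fix x assume x: "x \<in> C"
    have "m (vscale X (- 1) x) \<le> - g x" using m(3) q'(3)[OF x] by (force simp: le_fun_def intro: order_trans)
    then show "g x \<le> m x" using neg[of x] x C(1) by auto
  qed (rule scale)
qed

lemma sublinear_on_vnorm:
  assumes "K \<ge> 0" shows "sublinear_on X (\<lambda>x. K * vnorm X x)"
  using assms by (auto simp: sublinear_on_def vnorm_scale distrib_left[symmetric]
      intro!: mult_left_mono vnorm_triangle)

text \<open>A subspace is a cone that contains the negatives of its elements, so the one-sided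
  bounds of \<open>Hahn_Banach_cone\<close> turn into an equality on \<open>Y\<close> and a
  two-sided norm bound.\<close>

theorem Hahn_Banach_extension:
  assumes Y: "Y \<subseteq> pts X" "vzero X \<in> Y" "\<And>x y. \<lbrakk>x \<in> Y; y \<in> Y\<rbrakk> \<Longrightarrow> vadd X x y \<in> Y"
      "\<And>c x. x \<in> Y \<Longrightarrow> vscale X c x \<in> Y"
    and f: "\<And>x y. \<lbrakk>x \<in> Y; y \<in> Y\<rbrakk> \<Longrightarrow> f (vadd X x y) = f x + f y"
      "\<And>c x. x \<in> Y \<Longrightarrow> f (vscale X c x) = c * f x"
      "\<And>x. x \<in> Y \<Longrightarrow> \<bar>f x\<bar> \<le> K * vnorm X x"
    and K: "K \<ge> 0"
  obtains F where "\<And>x y. \<lbrakk>x \<in> pts X; y \<in> pts X\<rbrakk> \<Longrightarrow> F (vadd X x y) = F x + F y"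
    "\<And>c x. x \<in> pts X \<Longrightarrow> F (vscale X c x) = c * F x"
    "\<And>x. x \<in> pts X \<Longrightarrow> \<bar>F x\<bar> \<le> K * vnorm X x" "\<And>x. x \<in> Y \<Longrightarrow> F x = f x"
proof -
  obtain F where F: "\<And>x y. \<lbrakk>x \<in> pts X; y \<in> pts X\<rbrakk> \<Longrightarrow> F (vadd X x y) = F x + F y"
    "\<And>c x. x \<in> pts X \<Longrightarrow> F (vscale X c x) = c * F x"
    "\<And>x. x \<in> pts X \<Longrightarrow> F x \<le> K * vnorm X x" "\<And>x. x \<in> Y \<Longrightarrow> f x \<le> F x"
  proof (rule Hahn_Banach_cone[OF sublinear_on_vnorm[OF K] Y f(1,2)])
    show "f x \<le> K * vnorm X x" if "x \<in> Y" for x using f(3)[OF that] by simp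
  qed auto
  show thesis
  proof (rule that[OF F(1,2)])
    show "\<bar>F x\<bar> \<le> K * vnorm X x" if x: "x \<in> pts X" for x
      using F(3)[OF x] F(3)[OF scale_in[OF x], of "- 1"] F(2)[OF x, of "- 1"] vnorm_scale[OF x, of "- 1"]
      by (simp add: abs_le_iff)
    show "F x = f x" if x: "x \<in> Y" for x
      using F(4)[OF x] F(4)[OF Y(4)[OF x], of "- 1"] F(2)[of x "- 1"] f(2)[OF x, of "- 1"] x Y(1)
      by auto
  qed
qed

end

section \<open>Functionals on a Banach space that is given by a type\<close>

lemma copy_along_id_simps:
  "pts (copy_along (id :: 'x::real_normed_vector \<Rightarrow> 'x)) = UNIV"
  "vadd (copy_along (id :: 'x \<Rightarrow> 'x)) = (+)"
  "vzero (copy_along (id :: 'x \<Rightarrow> 'x)) = 0"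
  "vscale (copy_along (id :: 'x \<Rightarrow> 'x)) = (*\<^sub>R)"
  "vnorm (copy_along (id :: 'x \<Rightarrow> 'x)) = norm"
  by (simp_all add: copy_along_def fun_eq_iff)

text \<open>On the ray through \<open>a\<close> the functional \<open>q\<close> is linear, so
  \<open>Hahn_Banach_cone\<close> with \<open>g = q\<close> on this ray gives equality at
  \<open>a\<close>. The bound \<open>q \<le> norm\<close> yields
  \<open>norm f \<le> 1\<close>.\<close>

lemma dominated_functional:
  fixes q :: "'a::banach \<Rightarrow> real"
  assumes add: "\<And>x y. q (x + y) \<le> q x + q y"
    and scale: "\<And>c x. c > 0 \<Longrightarrow> q (c *\<^sub>R x) \<le> c * q x"
    and le: "\<And>x. q x \<le> norm x"
  obtains f :: "'a \<Rightarrow>\<^sub>L real" where "\<And>x. f x \<le> q x" "f a = q a" "norm f \<le> 1"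
proof -
  let ?X = "copy_along (id :: 'a \<Rightarrow> 'a)"
  interpret banach_space ?X by (rule banach_space_copy_along) simp
  have q: "sublinear_on ?X q"
    using add scale by (simp add: sublinear_on_def copy_along_id_simps)
  have qs: "q (c *\<^sub>R x) = c * q x" if "c \<ge> 0" for c x
    using sublinear_on_scale[OF q _ that] by (simp add: copy_along_id_simps)
  obtain F where F: "\<And>x y. F (x + y) = F x + F y" "\<And>c x. F (c *\<^sub>R x) = c * F x"
    "\<And>x. F x \<le> q x" "\<And>x. x \<in> (\<lambda>t. t *\<^sub>R a) ` {0..} \<Longrightarrow> q x \<le> F x"
  proof (rule Hahn_Banach_cone[OF q, of "(\<lambda>t. t *\<^sub>R a) ` {0..}" q, unfolded copy_along_id_simps])
    show "0 \<in> (\<lambda>t. t *\<^sub>R a) ` {0..}" by (rule image_eqI[of _ _ 0]) auto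
    show "x + y \<in> (\<lambda>t. t *\<^sub>R a) ` {0..}"
      if "x \<in> (\<lambda>t. t *\<^sub>R a) ` {0..}" "y \<in> (\<lambda>t. t *\<^sub>R a) ` {0..}" for x y
      using that by (auto simp: scaleR_left_distrib[symmetric])
    show "q (x + y) = q x + q y"
      if xy: "x \<in> (\<lambda>t. t *\<^sub>R a) ` {0..}" "y \<in> (\<lambda>t. t *\<^sub>R a) ` {0..}" for x y
    proof -
      obtain r t where "x = r *\<^sub>R a" "y = t *\<^sub>R a" "r \<ge> 0" "t \<ge> 0" using xy by auto
      then show ?thesis using qs[of "r + t" a] by (simp add: qs scaleR_left_distrib distrib_right)
    qed
  qed (auto simp: qs)
  have neg: "F (- x) = - F x" for x using F(2)[of "- 1" x] by simp
  have abs: "\<bar>F x\<bar> \<le> norm x" for x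
    using F(3)[of x] F(3)[of "- x"] le[of x] le[of "- x"] by (simp add: neg)
  have bl: "bounded_linear F"
    by (rule bounded_linear_intro[of _ 1]) (use F abs in auto)
  have "a \<in> (\<lambda>t. t *\<^sub>R a) ` {0..}" by (rule image_eqI[of _ _ 1]) auto
  then have "F a = q a" using F(3,4) by (simp add: antisym)
  then show thesis
    using F(3) abs by (intro that[of "Blinfun F"])
      (auto simp: bounded_linear_Blinfun_apply[OF bl] intro!: norm_blinfun_bound)
qed

lemma norming_functional:
  fixes a :: "'a::banach"
  obtains f :: "'a \<Rightarrow>\<^sub>L real" where "f a = norm a" "norm f \<le> 1"
  by (rule dominated_functional[of norm a]) (auto simp: norm_triangle_ineq intro: that)

text \<open>With \<open>infdist_subspace_scale\<close> this makes the distance to \<open>Y\<close>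
  sublinear, so that \<open>dominated_functional\<close> applies to it.\<close>

lemma infdist_subspace_add:
  fixes Y :: "'a::real_normed_vector set"
  assumes Y: "subspace Y"
  shows "infdist (x + x') Y \<le> infdist x Y + infdist x' Y"
proof -
  have ne: "Y \<noteq> {}" using subspace_0[OF Y] by blast
  have le: "infdist (x + x') Y \<le> dist x y + dist x' y'" if "y \<in> Y" "y' \<in> Y" for y y'
    using infdist_le[OF subspace_add[OF Y that], of "x + x'"] dist_triangle_add order_trans by blast
  have "infdist (x + x') Y - dist x y \<le> infdist x' Y" if y: "y \<in> Y" for y
    unfolding infdist_notempty[OF ne, of x']
    by (rule cINF_greatest[OF ne]) (use le[OF y] in \<open>simp add: algebra_simps\<close>)
  then have "infdist (x + x') Y - infdist x' Y \<le> infdist x Y"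
    unfolding infdist_notempty[OF ne, of x]
    by (intro cINF_greatest[OF ne]) (simp add: algebra_simps)
  then show ?thesis by simp
qed

lemma infdist_subspace_scale:
  fixes Y :: "'a::real_normed_vector set"
  assumes Y: "subspace Y" and c: "c > 0"
  shows "infdist (c *\<^sub>R x) Y \<le> c * infdist x Y"
proof -
  have ne: "Y \<noteq> {}" using subspace_0[OF Y] by blast
  have "infdist (c *\<^sub>R x) Y / c \<le> dist x y" if y: "y \<in> Y" for y
  proof -
    have "infdist (c *\<^sub>R x) Y \<le> dist (c *\<^sub>R x) (c *\<^sub>R y)"
      by (rule infdist_le[OF subspace_scale[OF Y y]])
    also have "\<dots> = c * dist x y"
      using c by (simp add: dist_norm scaleR_diff_right[symmetric])
    finally show ?thesis using c by (simp add: field_simps)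
  qed
  then have "infdist (c *\<^sub>R x) Y / c \<le> infdist x Y"
    unfolding infdist_notempty[OF ne, of x] by (intro cINF_greatest[OF ne])
  then show ?thesis using c by (simp add: field_simps)
qed

text \<open>The functional dominated by the distance to \<open>Y\<close> is at most 0 at
  \<open>y\<close> and at \<open>- y\<close>, hence 0 on \<open>Y\<close>. At \<open>a\<close> it
  equals the distance, and dividing by this number gives the value 1.\<close>

lemma annihilating_functional:
  fixes Y :: "'a::banach set"
  assumes Y: "subspace Y" and d: "d > 0" and dist: "\<And>y. y \<in> Y \<Longrightarrow> d \<le> dist a y"
  obtains f :: "'a \<Rightarrow>\<^sub>L real" where "\<And>y. y \<in> Y \<Longrightarrow> f y = 0" "f a = 1" "norm f \<le> 1 / d"
proof -
  have ne: "Y \<noteq> {}" using subspace_0[OF Y] by blast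
  have le: "infdist x Y \<le> norm x" for x
    using infdist_le[OF subspace_0[OF Y], of x] by simp
  obtain f :: "'a \<Rightarrow>\<^sub>L real" where f: "\<And>x. f x \<le> infdist x Y" "f a = infdist a Y" "norm f \<le> 1"
  proof (rule dominated_functional[where q = "\<lambda>x. infdist x Y" and a = a])
  qed (rule infdist_subspace_add[OF Y], erule infdist_subspace_scale[OF Y], rule le, rule that)
  have da: "d \<le> infdist a Y"
    unfolding infdist_notempty[OF ne] by (intro cINF_greatest[OF ne] dist)
  have f0: "f y = 0" if y: "y \<in> Y" for y
    using f(1)[of y] f(1)[of "- y"] y subspace_neg[OF Y y] by (simp add: blinfun.minus_right)
  have "norm ((1 / infdist a Y) *\<^sub>R f) = norm f / infdist a Y"
    using da d by simp
  also have "\<dots> \<le> 1 / d"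
    using f(3) da d by (intro frac_le) auto
  finally have "norm ((1 / infdist a Y) *\<^sub>R f) \<le> 1 / d" .
  then show thesis
    using f0 f(2) da d by (intro that[of "(1 / infdist a Y) *\<^sub>R f"]) (auto simp: blinfun.scaleR_left)
qed

section \<open>Bounded sequences\<close>

lemma linfty_abs_le_norm: "\<bar>apply_bcontfun (x :: linfty) n\<bar> \<le> norm x"
  using norm_bounded[of x n] by simp

lemma Bcontfun_apply:
  fixes a :: "nat \<Rightarrow> real"
  assumes "\<And>n. \<bar>a n\<bar> \<le> B"
  shows "apply_bcontfun (Bcontfun a) = a"
proof -
  have "bounded (range a)" by (rule boundedI[of _ B]) (use assms in auto)
  then show ?thesis by (intro Bcontfun_inverse) (simp add: bcontfun_def)
qed

definition linfty_ind :: "nat set \<Rightarrow> linfty" where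
  "linfty_ind A = Bcontfun (indicator A)"

definition linfty_abs :: "linfty \<Rightarrow> linfty" where
  "linfty_abs x = Bcontfun (\<lambda>n. \<bar>x n\<bar>)"

definition linfty_mult :: "linfty \<Rightarrow> linfty \<Rightarrow> linfty" where
  "linfty_mult x y = Bcontfun (\<lambda>n. x n * y n)"

definition linfty_pos :: "linfty \<Rightarrow> linfty" where
  "linfty_pos x = Bcontfun (\<lambda>n. max (x n) 0)"

lemma linfty_ind_apply [simp]: "linfty_ind A n = indicator A n"
  unfolding linfty_ind_def by (subst Bcontfun_apply[of _ 1]) (auto simp: indicator_def)

lemma linfty_abs_apply [simp]: "linfty_abs x n = \<bar>x n\<bar>"
  unfolding linfty_abs_def by (subst Bcontfun_apply[of _ "norm x"]) (auto simp: linfty_abs_le_norm)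

lemma linfty_mult_apply [simp]: "linfty_mult x y n = x n * y n"
  unfolding linfty_mult_def
  by (subst Bcontfun_apply[of _ "norm x * norm y"])
    (auto simp: abs_mult linfty_abs_le_norm intro: mult_mono)

lemma linfty_pos_apply [simp]: "linfty_pos x n = max (x n) 0"
  unfolding linfty_pos_def
  by (subst Bcontfun_apply[of _ "norm x"])
    (use linfty_abs_le_norm[of x] in \<open>auto simp: max_def abs_le_iff\<close>)

lemma norm_linfty_leI: "(\<And>n. \<bar>apply_bcontfun x n\<bar> \<le> b) \<Longrightarrow> norm (x :: linfty) \<le> b"
  by (rule norm_bound) simp

lemma norm_linfty_mono:
  "(\<And>n. \<bar>apply_bcontfun x n\<bar> \<le> \<bar>apply_bcontfun y n\<bar>) \<Longrightarrow> norm (x :: linfty) \<le> norm (y :: linfty)"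
  by (intro norm_linfty_leI) (metis linfty_abs_le_norm order_trans)

text \<open>Each coordinate of \<open>F\<close> is one functional; the common bound on their norms
  makes the values bounded sequences and \<open>F\<close> bounded.\<close>

lemma linfty_operator:
  fixes f :: "nat \<Rightarrow> 'a::real_normed_vector \<Rightarrow>\<^sub>L real"
  assumes C: "\<And>n. norm (f n) \<le> C"
  obtains F :: "'a \<Rightarrow>\<^sub>L linfty" where "\<And>x n. F x n = f n x"
proof -
  have b: "\<bar>f n x\<bar> \<le> C * norm x" for n x
    using norm_blinfun[of "f n" x] mult_right_mono[OF C[of n] norm_ge_zero[of x]] by simp
  define F where "F x = Bcontfun (\<lambda>n. f n x)" for x
  have F: "apply_bcontfun (F x) n = f n x" for x n
    unfolding F_def by (subst Bcontfun_apply[OF b]) simp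
  have "bounded_linear F"
    by (rule bounded_linear_intro[of _ C])
      (auto intro!: bcontfun_eqI norm_linfty_leI
        simp: F b blinfun.add_right blinfun.scaleR_right mult.commute[of _ C])
  then show thesis
    using F by (intro that[of "Blinfun F"]) (simp add: bounded_linear_Blinfun_apply)
qed

text \<open>\<open>W\<close> stands for the formal sum of the \<open>a k * b k\<close>, which need
  not converge in norm. Since the supports are disjoint it makes sense coordinate by coordinate, and
  each coordinate functional has norm at most 1.\<close>

lemma linfty_spread:
  fixes b :: "nat \<Rightarrow> linfty"
  assumes U: "disjoint_family U" and b: "\<And>k n. \<bar>apply_bcontfun (b k) n\<bar> \<le> indicator (U k) n"
  obtains W :: "linfty \<Rightarrow>\<^sub>L linfty" where "\<And>a k n. n \<in> U k \<Longrightarrow> W a n = a k * b k n"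
    "\<And>a n. (\<And>k. n \<notin> U k) \<Longrightarrow> W a n = 0" "\<And>k. W (linfty_ind {k}) = b k"
proof -
  have ev: "bounded_linear (\<lambda>x :: linfty. apply_bcontfun x k)" for k
    by (rule bounded_linear_intro[of _ 1]) (use linfty_abs_le_norm in auto)
  \<comment> \<open>Disjointness makes the \<open>k\<close> chosen by \<open>SOME\<close> unique;
    coordinates outside all \<open>U k\<close> get the zero functional.\<close>
  define f where "f n = (if \<exists>k. n \<in> U k then b (SOME k. n \<in> U k) n *\<^sub>R
    Blinfun (\<lambda>x :: linfty. apply_bcontfun x (SOME k. n \<in> U k)) else 0)" for n
  have uniq: "(SOME k. n \<in> U k) = k" if "n \<in> U k" for n k
    using that U by (auto simp: disjoint_family_on_def intro!: some_equality)
  have f1: "f n x = x k * b k n" if "n \<in> U k" for n k x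
    using that by (auto simp: f_def uniq[OF that] blinfun.scaleR_left bounded_linear_Blinfun_apply[OF ev])
  have f2: "f n = 0" if "\<And>k. n \<notin> U k" for n
    using that by (simp add: f_def)
  have "norm (f n) \<le> 1" for n
  proof (cases "\<exists>k. n \<in> U k")
    case True
    then obtain k where k: "n \<in> U k" by blast
    show ?thesis
    proof (rule norm_blinfun_bound)
      fix x :: linfty
      have "\<bar>x k\<bar> * \<bar>b k n\<bar> \<le> norm x * 1"
        using b[of k n] k by (intro mult_mono linfty_abs_le_norm) auto
      then show "norm (f n x) \<le> 1 * norm x" by (simp add: f1[OF k] abs_mult)
    qed simp
  qed (simp add: f2)
  then obtain W :: "linfty \<Rightarrow>\<^sub>L linfty" where W: "\<And>x n. W x n = f n x"
    using linfty_operator by blast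
  show thesis
  proof (rule that[of W])
    show "W (linfty_ind {k}) = b k" for k
    proof (rule bcontfun_eqI)
      fix n show "W (linfty_ind {k}) n = b k n"
      proof (cases "\<exists>l. n \<in> U l")
        case True
        then obtain l where l: "n \<in> U l" by blast
        show ?thesis
        proof (cases "l = k")
          case False
          then have "n \<notin> U k" using l uniq by metis
          then show ?thesis using False b[of k n] by (simp add: W f1[OF l])
        qed (simp add: W f1[OF l])
      next
        case False
        then show ?thesis using b[of k n] by (simp add: W f2)
      qed
    qed
  qed (simp_all add: W f1 f2)
qed

text \<open>The library has this instance only for metric domains, and \<^typ>\<open>nat\<close> is not of class
  \<^class>\<open>metric_space\<close>.\<close>

instance bcontfun :: (topological_space, complete_space) complete_space
proof
  fix f :: "nat \<Rightarrow> 'a \<Rightarrow>\<^sub>C 'b" assume f: "Cauchy f"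
  have "uniformly_Cauchy_on UNIV (\<lambda>n. apply_bcontfun (f n))"
  proof (rule uniformly_Cauchy_onI)
    fix e :: real assume "e > 0"
    then obtain M where "\<And>m n. \<lbrakk>m \<ge> M; n \<ge> M\<rbrakk> \<Longrightarrow> dist (f m) (f n) < e"
      using f unfolding Cauchy_def by meson
    then show "\<exists>M. \<forall>x\<in>UNIV. \<forall>m\<ge>M. \<forall>n\<ge>M. dist (f m x) (f n x) < e"
      by (meson dist_fun_lt_imp_dist_val_lt)
  qed
  then obtain g where "uniform_limit UNIV (\<lambda>n. apply_bcontfun (f n)) g sequentially"
    using Cauchy_uniformly_convergent unfolding uniformly_convergent_on_def by blast
  then show "convergent f"
    by (rule uniform_limit_bcontfunE) (auto intro: convergentI)
qed

instance bcontfun :: (topological_space, banach) banach ..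

text \<open>A bounded sequence is determined by the set of pairs \<open>(n, q)\<close> with
  \<open>q\<close> rational and below the \<open>n\<close>-th term. Sets of naturals embed into the
  reals, and the reals embed as the line through \<open>a\<close>. This serves to place a copy of
  \<open>linfty\<close> inside the type of the test spaces.\<close>

lemma inj_linfty:
  fixes a :: "'a::real_vector"
  assumes "a \<noteq> 0"
  obtains h :: "linfty \<Rightarrow> 'a" where "inj h"
proof -
  obtain F :: "nat set \<Rightarrow> real" where F: "inj F"
    using nat_sets_eqpoll_reals by (auto simp: eqpoll_def bij_betw_def)
  define code where "code x = {n. of_rat (snd (from_nat n :: nat \<times> rat)) < apply_bcontfun x (fst (from_nat n :: nat \<times> rat))}"
    for x :: linfty
  have "inj code"
  proof (rule injI, rule bcontfun_eqI, rule ccontr)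
    fix x y :: linfty and n assume eq: "code x = code y" and "x n \<noteq> y n"
    have *: "of_rat q < apply_bcontfun x n \<longleftrightarrow> of_rat q < apply_bcontfun y n" for q n
    proof -
      have "to_nat (n, q) \<in> code x \<longleftrightarrow> to_nat (n, q) \<in> code y" by (simp add: eq)
      then show ?thesis by (simp add: code_def)
    qed
    show False
    proof (cases "x n < y n")
      case True
      then show False using of_rat_dense[OF True] * less_asym by blast
    next
      case False
      then have "y n < x n" using \<open>x n \<noteq> y n\<close> by simp
      from of_rat_dense[OF this] show False using * less_asym by blast
    qed
  qed
  moreover have "inj (\<lambda>r. r *\<^sub>R a)" using assms by (auto intro: injI)
  ultimately have "inj ((\<lambda>r. r *\<^sub>R a) \<circ> F \<circ> code)"
    using F by (intro inj_compose)
  then show thesis by (rule that)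
qed

section \<open>Positive functionals and Grothendieck's theorem\<close>

abbreviation linfty_nonneg :: "linfty \<Rightarrow> bool" where
  "linfty_nonneg u \<equiv> \<forall>n. 0 \<le> apply_bcontfun u n"

text \<open>The Riesz-Kantorovich formula for the modulus of \<open>\<phi>\<close>. For
  \<open>u\<close> with a negative coordinate the supremum is over the empty set, so the rules below
  concern nonnegative \<open>u\<close>.\<close>

definition variation :: "(linfty \<Rightarrow>\<^sub>L real) \<Rightarrow> linfty \<Rightarrow> real" where
  "variation \<phi> u = (SUP x\<in>{x. \<forall>n. \<bar>apply_bcontfun x n\<bar> \<le> u n}. \<phi> x)"

lemma linfty_functional_le:
  fixes x u :: linfty
  assumes "\<And>n. \<bar>apply_bcontfun x n\<bar> \<le> apply_bcontfun u n"
  shows "blinfun_apply \<phi> x \<le> norm \<phi> * norm u"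
proof -
  have "norm x \<le> norm u"
  proof (rule norm_linfty_mono)
    show "\<bar>x n\<bar> \<le> \<bar>u n\<bar>" for n using assms[of n] by simp
  qed
  have "\<phi> x \<le> norm (\<phi> x)" by simp
  also have "\<dots> \<le> norm \<phi> * norm x" by (rule norm_blinfun)
  also have "\<dots> \<le> norm \<phi> * norm u" using \<open>norm x \<le> norm u\<close> by (simp add: mult_left_mono)
  finally show ?thesis .
qed

lemma variation_upper:
  assumes "\<And>n. \<bar>apply_bcontfun x n\<bar> \<le> apply_bcontfun u n"
  shows "blinfun_apply \<phi> x \<le> variation \<phi> u"
  unfolding variation_def
  by (rule cSUP_upper)
    (use assms in \<open>auto intro!: bdd_aboveI2[of _ _ "norm \<phi> * norm u"] linfty_functional_le\<close>)

lemma variation_least: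
  assumes "linfty_nonneg u"
    and "\<And>x. (\<And>n. \<bar>apply_bcontfun x n\<bar> \<le> apply_bcontfun u n) \<Longrightarrow> blinfun_apply \<phi> x \<le> r"
  shows "variation \<phi> u \<le> r"
  unfolding variation_def
proof (rule cSUP_least)
  show "{x. \<forall>n. \<bar>apply_bcontfun x n\<bar> \<le> apply_bcontfun u n} \<noteq> {}"
    using assms(1) by (auto intro!: exI[of _ 0])
qed (use assms(2) in auto)

lemma variation_ex:
  assumes "linfty_nonneg u" "r < variation \<phi> u"
  obtains x where "\<And>n. \<bar>apply_bcontfun x n\<bar> \<le> apply_bcontfun u n" "r < blinfun_apply \<phi> x"
proof -
  have "\<not> (\<forall>x. (\<forall>n. \<bar>apply_bcontfun x n\<bar> \<le> apply_bcontfun u n) \<longrightarrow> blinfun_apply \<phi> x \<le> r)"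
    using variation_least[OF assms(1), of \<phi> r] assms(2) by auto
  then show thesis using that by (meson not_le)
qed

lemma variation_nonneg: "linfty_nonneg u \<Longrightarrow> 0 \<le> variation \<phi> u"
  using variation_upper[of 0 u \<phi>] by simp

lemma variation_le_norm: "linfty_nonneg u \<Longrightarrow> variation \<phi> u \<le> norm \<phi> * norm u"
  by (rule variation_least) (auto intro: linfty_functional_le)

lemma variation_add:
  assumes u: "linfty_nonneg u" and v: "linfty_nonneg v"
  shows "variation \<phi> (u + v) = variation \<phi> u + variation \<phi> v"
proof (rule antisym)
  show "variation \<phi> (u + v) \<le> variation \<phi> u + variation \<phi> v"
  proof (rule variation_least)
    show "linfty_nonneg (u + v)" using u v by simp
    fix z assume z: "\<And>n. \<bar>apply_bcontfun z n\<bar> \<le> apply_bcontfun (u + v) n"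
    \<comment> \<open>Riesz decomposition: truncating \<open>z\<close> to the interval
      \<open>[- u, u]\<close> leaves a remainder bounded by \<open>v\<close>.\<close>
    define x where "x = Bcontfun (\<lambda>n. max (- u n) (min (u n) (z n)))"
    have x: "x n = max (- u n) (min (u n) (z n))" for n
      unfolding x_def
    proof (subst Bcontfun_apply[of _ "norm u"])
      fix n
      have "\<bar>max (- u n) (min (u n) (z n))\<bar> \<le> u n" using u[rule_format, of n]
        by (auto simp: abs_le_iff max_def min_def)
      also have "\<dots> \<le> norm u" using linfty_abs_le_norm[of u n] by simp
      finally show "\<bar>max (- u n) (min (u n) (z n))\<bar> \<le> norm u" .
    qed simp
    have "\<phi> x \<le> variation \<phi> u"
    proof (rule variation_upper)
      show "\<bar>x n\<bar> \<le> u n" for n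
        unfolding x using u[rule_format, of n] by (auto simp: abs_le_iff max_def min_def)
    qed
    moreover have "\<phi> (z - x) \<le> variation \<phi> v"
    proof (rule variation_upper)
      fix n show "\<bar>apply_bcontfun (z - x) n\<bar> \<le> apply_bcontfun v n"
        using z[of n] u[rule_format, of n] v[rule_format, of n]
        by (auto simp: x max_def min_def abs_le_iff)
    qed
    ultimately show "\<phi> z \<le> variation \<phi> u + variation \<phi> v" by (simp add: blinfun.diff_right)
  qed
next
  have "variation \<phi> u + blinfun_apply \<phi> y \<le> variation \<phi> (u + v)"
    if y: "\<And>n. \<bar>apply_bcontfun y n\<bar> \<le> apply_bcontfun v n" for y
  proof -
    have "\<phi> x \<le> variation \<phi> (u + v) - \<phi> y" if x: "\<And>n. \<bar>apply_bcontfun x n\<bar> \<le> apply_bcontfun u n" for x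
    proof -
      have "\<phi> (x + y) \<le> variation \<phi> (u + v)"
        by (rule variation_upper) (use x y in \<open>force intro: order_trans[OF abs_triangle_ineq] add_mono\<close>)
      then show ?thesis by (simp add: blinfun.add_right)
    qed
    then have "variation \<phi> u \<le> variation \<phi> (u + v) - \<phi> y" by (rule variation_least[OF u])
    then show ?thesis by simp
  qed
  then have "\<phi> y \<le> variation \<phi> (u + v) - variation \<phi> u"
    if "\<And>n. \<bar>apply_bcontfun y n\<bar> \<le> apply_bcontfun v n" for y
    using that by (simp add: algebra_simps)
  then have "variation \<phi> v \<le> variation \<phi> (u + v) - variation \<phi> u" by (rule variation_least[OF v])
  then show "variation \<phi> u + variation \<phi> v \<le> variation \<phi> (u + v)" by simp
qed

lemma variation_scale_le:
  assumes u: "linfty_nonneg u" and c: "c > 0"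
  shows "variation \<phi> (c *\<^sub>R u) \<le> c * variation \<phi> u"
proof (rule variation_least)
  fix x assume x: "\<And>n. \<bar>apply_bcontfun x n\<bar> \<le> apply_bcontfun (c *\<^sub>R u) n"
  have "\<phi> ((1 / c) *\<^sub>R x) \<le> variation \<phi> u"
    by (rule variation_upper) (use x c in \<open>simp add: abs_mult field_simps\<close>)
  then show "\<phi> x \<le> c * variation \<phi> u" using c by (simp add: blinfun.scaleR_right field_simps)
qed (use u c in auto)

lemma variation_scale:
  assumes u: "linfty_nonneg u" and c: "c \<ge> 0"
  shows "variation \<phi> (c *\<^sub>R u) = c * variation \<phi> u"
proof (cases "c = 0")
  case True
  have "variation \<phi> (0 + 0) = variation \<phi> 0 + variation \<phi> 0" by (rule variation_add) auto
  with True show ?thesis by simp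
next
  case False
  with c have c: "c > 0" by simp
  have "variation \<phi> ((1 / c) *\<^sub>R (c *\<^sub>R u)) \<le> (1 / c) * variation \<phi> (c *\<^sub>R u)"
    by (rule variation_scale_le) (use u c in auto)
  then show ?thesis
    using variation_scale_le[OF u c, of \<phi>] c by (simp add: field_simps)
qed

section \<open>Positive functionals, their inner products and Grothendieck's finiteness
  argument\<close>

locale positive_functional =
  fixes N :: "linfty \<Rightarrow> real"
  assumes nonneg: "linfty_nonneg u \<Longrightarrow> 0 \<le> N u"
    and add: "\<lbrakk>linfty_nonneg u; linfty_nonneg v\<rbrakk> \<Longrightarrow> N (u + v) = N u + N v"
    and scale: "\<lbrakk>linfty_nonneg u; c \<ge> 0\<rbrakk> \<Longrightarrow> N (c *\<^sub>R u) = c * N u"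
begin

lemma mono:
  assumes u: "linfty_nonneg u" and le: "\<And>n. apply_bcontfun u n \<le> apply_bcontfun v n"
  shows "N u \<le> N v"
proof -
  have vu: "linfty_nonneg (v - u)" using le by simp
  from add[OF u vu] nonneg[OF vu] show ?thesis by simp
qed

definition ext :: "linfty \<Rightarrow> real" where
  "ext x = N (linfty_pos x) - N (linfty_pos (- x))"

text \<open>The value does not depend on how an element is written as a difference of nonnegative
  ones, so linearity can be checked with convenient representations.\<close>

lemma ext_diff:
  assumes u: "linfty_nonneg u" and v: "linfty_nonneg v"
  shows "ext (u - v) = N u - N v"
proof -
  have "u + linfty_pos (- (u - v)) = v + linfty_pos (u - v)"
    by (rule bcontfun_eqI) (auto simp: max_def)
  then have "N u + N (linfty_pos (- (u - v))) = N v + N (linfty_pos (u - v))"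
    using add[OF u, of "linfty_pos (- (u - v))"] add[OF v, of "linfty_pos (u - v)"] by simp
  then show ?thesis by (simp add: ext_def)
qed

lemma zero: "N 0 = 0"
  using scale[of 0 0] by simp

lemma ext_nonneg: "linfty_nonneg u \<Longrightarrow> ext u = N u"
  using ext_diff[of u 0] by (simp add: zero)

lemma pos_neg: "x = linfty_pos x - linfty_pos (- x)"
  by (rule bcontfun_eqI) (auto simp: max_def)

lemma linear_ext: "linear ext"
proof (rule linearI)
  fix x y
  have "x + y = (linfty_pos x + linfty_pos y) - (linfty_pos (- x) + linfty_pos (- y))"
    by (rule bcontfun_eqI) (auto simp: max_def)
  then have "ext (x + y) = N (linfty_pos x + linfty_pos y) - N (linfty_pos (- x) + linfty_pos (- y))"
    by (simp add: ext_diff)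
  then show "ext (x + y) = ext x + ext y" by (simp add: add ext_def)
next
  fix c x
  have pos: "ext (c *\<^sub>R x) = c * ext x" if c: "c \<ge> 0" for c x
  proof -
    have "c *\<^sub>R x = c *\<^sub>R linfty_pos x - c *\<^sub>R linfty_pos (- x)"
      using pos_neg[of x] by (metis scaleR_right_diff_distrib)
    then have "ext (c *\<^sub>R x) = N (c *\<^sub>R linfty_pos x) - N (c *\<^sub>R linfty_pos (- x))"
      using c by (simp add: ext_diff)
    then show ?thesis using c by (simp add: scale ext_def algebra_simps)
  qed
  have "ext (- x) = - ext x" for x by (simp add: ext_def)
  then show "ext (c *\<^sub>R x) = c *\<^sub>R ext x"
    using pos[of c x] pos[of "- c" x] by (cases "c \<ge> 0") (auto simp: minus_equation_iff[of "ext _"])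
qed

text \<open>The L2 inner product for the finitely additive integral \<open>ext\<close>; in general
  it is only positive semidefinite.\<close>

definition inn :: "linfty \<Rightarrow> linfty \<Rightarrow> real" where
  "inn x y = ext (linfty_mult x y)"

lemma inn_commute: "inn x y = inn y x"
proof -
  have "linfty_mult x y = linfty_mult y x" by (rule bcontfun_eqI) simp
  then show ?thesis by (simp add: inn_def)
qed

lemma linear_inn: "linear (inn x)"
proof -
  have "linear (linfty_mult x)"
    by (intro linearI bcontfun_eqI) (simp_all add: algebra_simps)
  from linear_compose[OF this linear_ext] show ?thesis by (simp add: inn_def[abs_def] o_def)
qed

lemma linear_inn_left: "linear (\<lambda>x. inn x y)"
  using linear_inn[of y] by (subst inn_commute)

lemma inn_self: "inn x x = N (linfty_mult x x)"
  by (simp add: inn_def ext_nonneg)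

text \<open>Coordinatewise \<open>\<bar>t\<bar> \<le> (a + t\<^sup>2 / a) / 2\<close>. This bounds
  the L1 norm by the L2 norm, with a free parameter in place of the Cauchy-Schwarz
  inequality.\<close>

lemma abs_le_inn:
  assumes a: "a > 0"
  shows "N (linfty_abs x) \<le> (a * N (linfty_ind UNIV) + inn x x / a) / 2"
proof -
  have "N (linfty_abs x) \<le> N ((a / 2) *\<^sub>R linfty_ind UNIV + (1 / (2 * a)) *\<^sub>R linfty_mult x x)"
  proof (rule mono)
    fix n
    have "0 \<le> (a - \<bar>x n\<bar>)\<^sup>2" by simp
    then show "linfty_abs x n \<le> ((a / 2) *\<^sub>R linfty_ind UNIV + (1 / (2 * a)) *\<^sub>R linfty_mult x x) n"
      using a by (simp add: field_simps power2_eq_square)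
  qed simp
  also have "\<dots> = (a * N (linfty_ind UNIV) + inn x x / a) / 2"
    using a by (subst add) (simp_all add: scale inn_self add_divide_distrib)
  finally show ?thesis .
qed

text \<open>If \<open>inn x x = 0\<close>, then small values of \<open>a\<close> in
  \<open>abs_le_inn\<close> push the L1 norm to 0, and by assumption the supremum norm with
  it.\<close>

lemma inn_self_pos:
  assumes x: "x \<noteq> 0" and C: "norm x \<le> C * N (linfty_abs x)" "C \<ge> 0"
  shows "inn x x > 0"
proof (rule ccontr)
  assume "\<not> inn x x > 0"
  moreover have "inn x x \<ge> 0" by (simp add: inn_self nonneg)
  ultimately have 0: "inn x x = 0" by simp
  define K where "K = C * N (linfty_ind UNIV)"
  have K: "K \<ge> 0" using C by (simp add: K_def nonneg)
  have *: "norm x \<le> a * K / 2" if "a > 0" for a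
  proof -
    have "norm x \<le> C * ((a * N (linfty_ind UNIV)) / 2)"
      using C(1) mult_left_mono[OF abs_le_inn[OF that, of x] C(2)] 0 by simp
    then show ?thesis by (simp add: K_def mult.commute mult.left_commute)
  qed
  have "norm x > 0" using x by simp
  \<comment> \<open>This \<open>a\<close> is small enough for the right-hand side to stay below
    \<open>norm x\<close>; the summand 1 covers \<open>K = 0\<close>.\<close>
  then have "norm x \<le> norm x / (K + 1) * K / 2" using K by (intro *) simp
  also have "\<dots> = norm x * (K / (K + 1)) / 2" by simp
  also have "\<dots> \<le> norm x * 1 / 2" using K by (intro divide_right_mono mult_left_mono) simp_all
  finally show False using \<open>norm x > 0\<close> by simp
qed

text \<open>Gram-Schmidt inside \<open>W\<close>. The norm inequality enters through
  \<open>inn_self_pos\<close>, which allows the new vector to be normalised.\<close>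

lemma orthonormal_extend:
  assumes W: "subspace W" and C: "\<And>x. x \<in> W \<Longrightarrow> norm x \<le> C * N (linfty_abs x)" "C \<ge> 0"
    and inf: "\<And>B. finite B \<Longrightarrow> \<not> W \<subseteq> span B"
  shows "\<exists>x :: nat \<Rightarrow> linfty. (\<forall>i<n. x i \<in> W) \<and>
           (\<forall>i<n. \<forall>j<n. inn (x i) (x j) = (if i = j then 1 else 0))"
proof (induction n)
  case 0
  show ?case by simp
next
  case (Suc n)
  then obtain x :: "nat \<Rightarrow> linfty" where x: "\<And>i. i < n \<Longrightarrow> x i \<in> W"
    "\<And>i j. \<lbrakk>i < n; j < n\<rbrakk> \<Longrightarrow> inn (x i) (x j) = (if i = j then 1 else 0)" by auto
  obtain y where y: "y \<in> W" "y \<notin> span (x ` {..<n})" using inf[of "x ` {..<n}"] by auto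
  define z where "z = y - (\<Sum>i<n. inn y (x i) *\<^sub>R x i)"
  have z: "z \<in> W"
    unfolding z_def using W x y by (intro subspace_diff subspace_sum subspace_scale) auto
  have z0: "z \<noteq> 0"
  proof
    assume "z = 0"
    then have "y = (\<Sum>i<n. inn y (x i) *\<^sub>R x i)" by (simp add: z_def)
    also have "\<dots> \<in> span (x ` {..<n})" by (intro span_sum span_scale span_base) auto
    finally show False using y(2) by simp
  qed
  have zx: "inn z (x j) = 0" if j: "j < n" for j
  proof -
    have "inn z (x j) = inn y (x j) - (\<Sum>i<n. inn y (x i) * inn (x i) (x j))"
      unfolding z_def
      by (simp add: linear_diff[OF linear_inn_left] linear_sum[OF linear_inn_left]
          linear_cmul[OF linear_inn_left])
    also have "(\<Sum>i<n. inn y (x i) * inn (x i) (x j)) = (\<Sum>i<n. if i = j then inn y (x j) else 0)"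
      by (rule sum.cong) (auto simp: x(2) j)
    also have "\<dots> = inn y (x j)" using j by simp
    finally show ?thesis by simp
  qed
  have zz: "inn z z > 0" by (rule inn_self_pos[OF z0 C(1)[OF z] C(2)])
  define w where "w = (1 / sqrt (inn z z)) *\<^sub>R z"
  have w: "w \<in> W" unfolding w_def by (rule subspace_scale[OF W z])
  have wx: "inn w (x j) = 0" if "j < n" for j
    unfolding w_def using zx[OF that] by (simp add: linear_cmul[OF linear_inn_left])
  have ww: "inn w w = 1"
    unfolding w_def using zz
    by (simp add: linear_cmul[OF linear_inn_left] linear_cmul[OF linear_inn] divide_simps)
  show ?case
  proof (intro exI[of _ "x(n := w)"] conjI allI impI)
    show "(x(n := w)) i \<in> W" if "i < Suc n" for i
      using that w x(1) by auto
    show "inn ((x(n := w)) i) ((x(n := w)) j) = (if i = j then 1 else 0)"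
      if "i < Suc n" "j < Suc n" for i j
    proof (cases "i < n \<and> j < n")
      case True
      then show ?thesis using x(2)[of i j] by simp
    next
      case False
      then show ?thesis using that wx[of i] wx[of j] ww inn_commute[of w "x i"]
        by (auto simp: less_Suc_eq)
    qed
  qed
qed

text \<open>Testing the norm inequality on \<open>\<Sum>i. x i k *\<^sub>R x i\<close> bounds \<open>\<Sum>i. (x i k)\<^sup>2\<close> uniformly in \<open>k\<close>;
  applying \<open>N\<close> to this sum of squares gives \<open>n\<close>.\<close>

lemma orthonormal_bound:
  assumes W: "subspace W" and C: "\<And>x. x \<in> W \<Longrightarrow> norm x \<le> C * N (linfty_abs x)" "C \<ge> 0"
    and x: "\<And>i. i < n \<Longrightarrow> x i \<in> W"
      "\<And>i j. \<lbrakk>i < n; j < n\<rbrakk> \<Longrightarrow> inn (x i) (x j) = (if i = j then 1 else (0::real))"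
  shows "real n \<le> (C * ((N (linfty_ind UNIV) + 1) / 2))\<^sup>2 * N (linfty_ind UNIV)"
proof -
  \<comment> \<open>By \<open>abs_le_inn\<close> with \<open>a = 1\<close>, this bounds the supremum
    norm of every \<open>z\<close> in \<open>W\<close> with \<open>inn z z = 1\<close>.\<close>
  define D where "D = C * ((N (linfty_ind UNIV) + 1) / 2)"
  have sumsq: "(\<Sum>i<n. (x i k)\<^sup>2) \<le> D\<^sup>2" for k
  proof (cases "(\<Sum>i<n. (x i k)\<^sup>2) = 0")
    case False
    define s where "s = sqrt (\<Sum>i<n. (x i k)\<^sup>2)"
    have s2: "s\<^sup>2 = (\<Sum>i<n. (x i k)\<^sup>2)" by (simp add: s_def sum_nonneg)
    have "s > 0" using False by (simp add: s_def sum_nonneg order_less_le)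
    \<comment> \<open>Dividing by \<open>s\<close> makes \<open>inn z z = 1\<close>, while the
      \<open>k\<close>-th coordinate of \<open>z\<close> becomes \<open>s\<close> itself.\<close>
    define z where "z = (\<Sum>i<n. (x i k / s) *\<^sub>R x i)"
    have z: "z \<in> W" unfolding z_def using W x(1) by (intro subspace_sum subspace_scale) auto
    have "inn z z = (\<Sum>i<n. \<Sum>j<n. (x i k / s) * ((x j k / s) * inn (x i) (x j)))"
    proof -
      have "inn z z = (\<Sum>i<n. (x i k / s) * inn (x i) z)"
        by (subst (1) z_def)
          (simp add: linear_sum[OF linear_inn_left] linear_cmul[OF linear_inn_left])
      also have "\<dots> = (\<Sum>i<n. (x i k / s) * (\<Sum>j<n. (x j k / s) * inn (x i) (x j)))"
        by (subst z_def) (simp add: linear_sum[OF linear_inn] linear_cmul[OF linear_inn])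
      finally show ?thesis by (simp add: sum_distrib_left)
    qed
    also have "\<dots> = (\<Sum>i<n. \<Sum>j<n. if i = j then (x i k / s)\<^sup>2 else 0)"
      by (intro sum.cong refl) (auto simp: x(2) power2_eq_square)
    also have "\<dots> = (\<Sum>i<n. (x i k)\<^sup>2) / s\<^sup>2"
      by (simp add: power_divide sum_divide_distrib)
    also have "\<dots> = 1" unfolding s2[symmetric] using \<open>s > 0\<close> by simp
    finally have zz: "inn z z = 1" .
    have "z k = (\<Sum>i<n. (x i k)\<^sup>2) / s"
    proof -
      have lin: "linear (\<lambda>y :: linfty. apply_bcontfun y k)" by (intro linearI) auto
      have "z k = (\<Sum>i<n. (x i k / s) * x i k)"
        unfolding z_def by (simp add: linear_sum[OF lin])
      then show ?thesis by (simp add: power2_eq_square sum_divide_distrib)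
    qed
    then have "z k = s\<^sup>2 / s" unfolding s2 .
    then have "z k = s" using \<open>s > 0\<close> by (simp add: power2_eq_square)
    then have "s \<le> norm z" using linfty_abs_le_norm[of z k] by simp
    also have "\<dots> \<le> C * N (linfty_abs z)" by (rule C(1)[OF z])
    also have "\<dots> \<le> D"
      unfolding D_def using abs_le_inn[of 1 z] zz C(2) by (intro mult_left_mono) auto
    finally have "s\<^sup>2 \<le> D\<^sup>2" using \<open>s > 0\<close> by (intro power_mono) auto
    then show ?thesis using s2 by simp
  qed simp
  have sum_apply: "apply_bcontfun (\<Sum>i<n. linfty_mult (x i) (x i)) k = (\<Sum>i<n. (x i k)\<^sup>2)" for k
  proof -
    have lin: "linear (\<lambda>y :: linfty. apply_bcontfun y k)" by (intro linearI) auto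
    then show ?thesis by (simp add: linear_sum[OF lin] power2_eq_square)
  qed
  have "real n = (\<Sum>i<n. inn (x i) (x i))" by (simp add: x(2))
  also have "\<dots> = ext (\<Sum>i<n. linfty_mult (x i) (x i))"
    by (simp add: inn_def linear_sum[OF linear_ext])
  also have "\<dots> = N (\<Sum>i<n. linfty_mult (x i) (x i))"
    by (rule ext_nonneg) (simp add: sum_apply sum_nonneg)
  also have "\<dots> \<le> N (D\<^sup>2 *\<^sub>R linfty_ind UNIV)"
    by (rule mono) (use sumsq in \<open>simp_all add: sum_apply sum_nonneg\<close>)
  also have "\<dots> = D\<^sup>2 * N (linfty_ind UNIV)" by (simp add: scale)
  finally show ?thesis by (simp add: D_def)
qed

text \<open>The bound on the length of orthonormal systems does not involve the system, whereas an
  infinite-dimensional \<open>W\<close> would contain arbitrarily long ones.\<close>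

theorem finite_dim_of_norm_le:
  assumes W: "subspace W" and C: "\<And>x. x \<in> W \<Longrightarrow> norm x \<le> C * N (linfty_abs x)" "C \<ge> 0"
  obtains B where "finite B" "W \<subseteq> span B"
proof -
  have "\<exists>B. finite B \<and> W \<subseteq> span B"
  proof (rule ccontr)
    assume inf: "\<nexists>B. finite B \<and> W \<subseteq> span B"
    obtain n :: nat where n: "(C * ((N (linfty_ind UNIV) + 1) / 2))\<^sup>2 * N (linfty_ind UNIV) < real n"
      using reals_Archimedean2 by blast
    obtain x :: "nat \<Rightarrow> linfty" where x: "\<And>i. i < n \<Longrightarrow> x i \<in> W"
      "\<And>i j. \<lbrakk>i < n; j < n\<rbrakk> \<Longrightarrow> inn (x i) (x j) = (if i = j then 1 else 0)"
      using orthonormal_extend[OF W C, of n] inf by blast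
    have "real n \<le> (C * ((N (linfty_ind UNIV) + 1) / 2))\<^sup>2 * N (linfty_ind UNIV)"
      by (rule orthonormal_bound[OF W C, where x = x]) (simp_all add: x)
    with n show False by simp
  qed
  then show thesis using that by blast
qed

end

section \<open>Disjointification and Rosenthal's lemma\<close>

text \<open>The intended instance is the modulus of a bounded sequence of functionals, evaluated at
  indicators.\<close>

locale finitely_additive_family =
  fixes \<mu> :: "nat \<Rightarrow> nat set \<Rightarrow> real" and M :: real
  assumes nonneg: "0 \<le> \<mu> i A"
    and add: "A \<inter> B = {} \<Longrightarrow> \<mu> i (A \<union> B) = \<mu> i A + \<mu> i B"
    and bound: "\<mu> i UNIV \<le> M"
begin

lemma empty [simp]: "\<mu> i {} = 0"
  using add[of "{}" "{}" i] by simp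

lemma mono: "A \<subseteq> B \<Longrightarrow> \<mu> i A \<le> \<mu> i B"
  using add[of A "B - A" i] nonneg[of i "B - A"] by (simp add: Un_absorb1)

lemma diff_ge: "\<mu> i (A - B) \<ge> \<mu> i A - \<mu> i B"
proof -
  have "\<mu> i ((A - B) \<union> (A \<inter> B)) = \<mu> i (A - B) + \<mu> i (A \<inter> B)" by (rule add) blast
  then show ?thesis using mono[of "A \<inter> B" B i] by (simp add: Un_Diff_Int)
qed

lemma sum_disjoint:
  assumes "finite I" "\<And>a b. \<lbrakk>a \<in> I; b \<in> I; a \<noteq> b\<rbrakk> \<Longrightarrow> D a \<inter> D b = {}"
  shows "\<mu> i (\<Union>a\<in>I. D a) = (\<Sum>a\<in>I. \<mu> i (D a))"
  using assms
proof (induction I)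
  case (insert x I)
  have "\<mu> i (D x \<union> (\<Union>a\<in>I. D a)) = \<mu> i (D x) + \<mu> i (\<Union>a\<in>I. D a)"
    using insert.hyps insert.prems by (intro add) fastforce
  then show ?case using insert by simp
qed simp

lemma sum_subadditive:
  assumes "finite I" shows "\<mu> i (\<Union>a\<in>I. D a) \<le> (\<Sum>a\<in>I. \<mu> i (D a))"
  using assms
proof (induction I)
  case (insert x I)
  have "\<mu> i (D x \<union> (\<Union>a\<in>I. D a)) = \<mu> i (D x) + \<mu> i ((\<Union>a\<in>I. D a) - D x)"
    using add[of "D x" "(\<Union>a\<in>I. D a) - D x" i] by (simp add: Diff_disjoint)
  also have "\<dots> \<le> \<mu> i (D x) + \<mu> i (\<Union>a\<in>I. D a)" by (simp add: mono)
  finally show ?case using insert by simp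
qed simp

text \<open>Since \<open>\<mu>\<close> need not be countably additive, the small sets \<open>A n\<close> with large \<open>n\<close> cannot be
  removed all at once. Instead, make finitely many of the sets \<open>A j - B\<close> disjoint; each measure is small
  on one of them, and by the pigeonhole principle infinitely many measures are small on the same one.\<close>

lemma disjointify_step:
  fixes J :: "nat set" and A :: "nat \<Rightarrow> nat set"
  assumes J: "infinite J" and big: "\<And>j. j \<in> J \<Longrightarrow> e \<le> \<mu> j (A j - B)"
    and small: "\<And>i n. i < n \<Longrightarrow> \<mu> i (A n) \<le> d * (1/2) ^ (n + 1)"
    and d: "d \<ge> 0" and \<eta>: "\<eta> > 0"
  obtains i U J' where "U \<inter> B = {}" "e - d \<le> \<mu> i U" "infinite J'"
    "\<And>j. j \<in> J' \<Longrightarrow> e - \<eta> \<le> \<mu> j (A j - (B \<union> U))"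
proof -
  define s where "s = enumerate J"
  have s: "strict_mono s" "\<And>a. s a \<in> J"
    using J by (simp_all add: s_def strict_mono_enumerate enumerate_in_set)
  \<comment> \<open>So many disjoint sets cannot all have measure above \<open>\<eta>\<close>, as
    the total mass is at most \<open>M\<close>.\<close>
  obtain N :: nat where N: "M / \<eta> < real N" using reals_Archimedean2 by blast
  \<comment> \<open>Removing only the later sets already makes the \<open>D a\<close> with
    \<open>a < N\<close> disjoint, and these are the sets that \<open>\<mu> (s a)\<close> sees as
    small. Since \<open>b \<le> s b\<close>, the total loss is at most a geometric sum, hence at
    most \<open>d\<close>.\<close>
  define D where "D a = A (s a) - B - (\<Union>b\<in>{a<..<N}. A (s b))" for a
  have disj: "D a \<inter> D b = {}" if "a \<in> {..<N}" "b \<in> {..<N}" "a \<noteq> b" for a b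
    using that by (cases "a < b") (auto simp: D_def)
  have big': "e - d \<le> \<mu> (s a) (D a)" for a
  proof -
    have "\<mu> (s a) (\<Union>b\<in>{a<..<N}. A (s b)) \<le> (\<Sum>b\<in>{a<..<N}. \<mu> (s a) (A (s b)))"
      by (rule sum_subadditive) simp
    also have "\<dots> \<le> (\<Sum>b\<in>{a<..<N}. d * (1/2) ^ (b + 1))"
    proof (rule sum_mono)
      fix b assume b: "b \<in> {a<..<N}"
      have "\<mu> (s a) (A (s b)) \<le> d * (1/2) ^ (s b + 1)"
        using b s(1) by (intro small) (simp add: strict_mono_def)
      also have "\<dots> \<le> d * (1/2) ^ (b + 1)"
        using d strict_mono_imp_increasing[OF s(1), of b] by (intro mult_left_mono power_decreasing) auto
      finally show "\<mu> (s a) (A (s b)) \<le> d * (1/2) ^ (b + 1)" .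
    qed
    also have "\<dots> \<le> (\<Sum>b<N. d * (1/2) ^ (b + 1))"
      using d by (intro sum_mono2) auto
    also have "\<dots> = d * (1 - (1/2) ^ N)"
      by (induction N) (simp_all add: field_simps)
    also have "\<dots> \<le> d" using d by (simp add: mult_left_le)
    finally show ?thesis
      using big[OF s(2), of a] diff_ge[where A = "A (s a) - B" and B = "\<Union>b\<in>{a<..<N}. A (s b)" and i = "s a"]
      unfolding D_def by linarith
  qed
  have ex: "\<exists>a<N. \<mu> j (D a) \<le> \<eta>" for j
  proof (rule ccontr)
    assume "\<not> ?thesis"
    then have "real N * \<eta> \<le> (\<Sum>a<N. \<mu> j (D a))"
      using sum_mono[of "{..<N}" "\<lambda>_. \<eta>" "\<lambda>a. \<mu> j (D a)"] by force
    also have "\<dots> = \<mu> j (\<Union>a\<in>{..<N}. D a)" by (rule sum_disjoint[symmetric]) (use disj in auto)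
    also have "\<dots> \<le> M" using mono[of _ UNIV j] bound[of j] order_trans by blast
    finally show False using N \<eta> by (simp add: field_simps)
  qed
  have "J \<subseteq> (\<Union>a\<in>{..<N}. {j \<in> J. \<mu> j (D a) \<le> \<eta>})"
    using ex by (fastforce intro: exI)
  with J have "infinite (\<Union>a\<in>{..<N}. {j \<in> J. \<mu> j (D a) \<le> \<eta>})"
    using finite_subset by blast
  then obtain a where a: "infinite {j \<in> J. \<mu> j (D a) \<le> \<eta>}" by auto
  show thesis
  proof (rule that[of "D a" "s a" "{j \<in> J. \<mu> j (D a) \<le> \<eta>}"])
    show "e - \<eta> \<le> \<mu> j (A j - (B \<union> D a))" if "j \<in> {j \<in> J. \<mu> j (D a) \<le> \<eta>}" for j
      using that big[of j] diff_ge[where A = "A j - B" and B = "D a" and i = j]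
      by (simp add: Diff_eq Int_assoc)
  qed (use a big' in \<open>auto simp: D_def\<close>)
qed

text \<open>Iterate \<open>disjointify_step\<close>. The first component of the state holds the
  indices still available, the second the union of the sets chosen so far; each new set avoids that
  union.\<close>

lemma disjointify:
  fixes A :: "nat \<Rightarrow> nat set"
  assumes \<epsilon>: "\<epsilon> > 0" and big: "\<And>n. \<epsilon> \<le> \<mu> n (A n)"
    and small: "\<And>i n. i < n \<Longrightarrow> \<mu> i (A n) \<le> \<epsilon> / 4 * (1/2) ^ (n + 1)"
  obtains s :: "nat \<Rightarrow> nat" and U :: "nat \<Rightarrow> nat set"
    where "disjoint_family U" "\<And>k. \<epsilon> / 2 \<le> \<mu> (s k) (U k)"
proof -
  \<comment> \<open>The mass guaranteed after \<open>k\<close> steps decreases from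
    \<open>\<epsilon>\<close> but stays above \<open>3/4 * \<epsilon>\<close>; a further loss of
    \<open>\<epsilon> / 4\<close> in choosing \<open>U k\<close> leaves
    \<open>\<epsilon> / 2\<close>.\<close>
  define e where "e k = \<epsilon> * (3/4 + (1/4) * (1/2) ^ k)" for k :: nat
  define P where "P k JB \<longleftrightarrow> infinite (fst JB) \<and> (\<forall>j\<in>fst JB. e k \<le> \<mu> j (A j - snd JB))"
    for k and JB :: "nat set \<times> nat set"
  define Q where "Q JB JB' i U \<longleftrightarrow> U \<inter> snd JB = {} \<and> snd JB' = snd JB \<union> U \<and> \<epsilon> / 2 \<le> \<mu> i U"
    for JB JB' :: "nat set \<times> nat set" and i U
  have "\<exists>f. \<forall>k. P k (f k) \<and> (\<exists>i U. Q (f k) (f (Suc k)) i U)"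
  proof (rule dependent_nat_choice)
    show "\<exists>JB. P 0 JB" using big by (intro exI[of _ "(UNIV, {})"]) (simp add: P_def e_def)
  next
    fix JB k assume JB: "P k JB"
    have "e k - e (Suc k) > 0" using \<epsilon> by (simp add: e_def algebra_simps)
    obtain U i J' where *: "U \<inter> snd JB = {}" "e k - \<epsilon> / 4 \<le> \<mu> i U" "infinite J'"
      "\<And>j. j \<in> J' \<Longrightarrow> e k - (e k - e (Suc k)) \<le> \<mu> j (A j - (snd JB \<union> U))"
    proof (rule disjointify_step[of "fst JB" "e k" A "snd JB" "\<epsilon> / 4" "e k - e (Suc k)"])
      show "\<mu> i (A n) \<le> \<epsilon> / 4 * (1/2) ^ (n + 1)" if "i < n" for i n by (rule small[OF that])
    qed (use JB \<epsilon> \<open>e k - e (Suc k) > 0\<close> in \<open>simp_all add: P_def\<close>)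
    have "\<epsilon> / 2 \<le> e k - \<epsilon> / 4" using \<epsilon> by (simp add: e_def algebra_simps)
    then show "\<exists>JB'. P (Suc k) JB' \<and> (\<exists>i U. Q JB JB' i U)"
      using * by (intro exI[of _ "(J', snd JB \<union> U)"] conjI exI[of _ i] exI[of _ U])
        (auto simp: P_def Q_def)
  qed
  then obtain f where f: "\<And>k. \<exists>i U. Q (f k) (f (Suc k)) i U" by blast
  then obtain s U where Q: "\<And>k. Q (f k) (f (Suc k)) (s k) (U k)" by metis
  have mono: "snd (f k) \<subseteq> snd (f l)" if "k \<le> l" for k l
    by (rule lift_Suc_mono_le[OF _ that]) (use Q in \<open>auto simp: Q_def\<close>)
  have disj: "U k \<inter> U l = {}" if "k < l" for k l
    using Q[of k] Q[of l] mono[of "Suc k" l] that by (auto simp: Q_def)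
  have "disjoint_family U"
    unfolding disjoint_family_on_def by (metis disj Int_commute linorder_neqE_nat)
  then show thesis using Q by (intro that[of U s]) (auto simp: Q_def)
qed

text \<open>Split \<open>N\<close> into infinitely many infinite parts. If every part \<open>P p\<close> contains a bad index \<open>k p\<close>,
  then the measures \<open>\<mu> (k p)\<close> lose mass \<open>\<epsilon>\<close> on the set of bad indices.\<close>

lemma Rosenthal_within:
  assumes \<epsilon>: "\<epsilon> > 0"
  shows "\<lbrakk>infinite N; \<And>k. k \<in> N \<Longrightarrow> \<mu> k N \<le> real n * \<epsilon>\<rbrakk>
    \<Longrightarrow> \<exists>S\<subseteq>N. infinite S \<and> (\<forall>k\<in>S. \<mu> k (S - {k}) \<le> \<epsilon>)"
proof (induction n arbitrary: N)
  case 0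
  have "\<mu> k (N - {k}) \<le> \<epsilon>" if "k \<in> N" for k
    using mono[of "N - {k}" N k] 0(2)[OF that] \<epsilon> by auto
  with 0(1) show ?case by blast
next
  case (Suc n)
  define P where "P p = enumerate N ` {m. fst (prod_decode m) = p}" for p
  have inj: "inj (enumerate N)" using Suc.prems(1) strict_mono_enumerate strict_mono_imp_inj_on by blast
  have PN: "P p \<subseteq> N" for p using Suc.prems(1) by (auto simp: P_def enumerate_in_set)
  have disj: "P p \<inter> P q = {}" if "p \<noteq> q" for p q
    using that inj by (auto simp: P_def inj_eq)
  have inf: "infinite (P p)" for p
  proof -
    have "range (\<lambda>q. prod_encode (p, q)) \<subseteq> {m. fst (prod_decode m) = p}" by auto
    moreover have "infinite (range (\<lambda>q. prod_encode (p, q)))"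
      by (rule range_inj_infinite) (auto simp: inj_def)
    ultimately have "infinite {m. fst (prod_decode m) = p}" using finite_subset by blast
    then show ?thesis using inj finite_imageD inj_on_subset unfolding P_def by blast
  qed
  show ?case
  proof (cases "\<exists>p. \<forall>k\<in>P p. \<mu> k (P p - {k}) \<le> \<epsilon>")
    case True
    then show ?thesis using PN inf by blast
  next
    case False
    then obtain k where k: "\<And>p. k p \<in> P p" "\<And>p. \<epsilon> < \<mu> (k p) (P p - {k p})"
      by (metis not_le)
    have injk: "inj k" using disj k(1) by (metis disjoint_iff injI)
    have "\<exists>S\<subseteq>range k. infinite S \<and> (\<forall>k\<in>S. \<mu> k (S - {k}) \<le> \<epsilon>)"
    proof (rule Suc.IH)
      show "infinite (range k)" by (rule range_inj_infinite[OF injk])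
      fix j assume "j \<in> range k"
      then obtain p where j: "j = k p" by blast
      \<comment> \<open>For \<open>q \<noteq> p\<close> the index \<open>k q\<close> lies in another
        part, and \<open>k p\<close> itself has been removed.\<close>
      have "k q \<notin> P p - {k p}" for q
        by (cases "q = p") (use disj[of q p] k(1)[of q] in auto)
      then have "(P p - {k p}) \<inter> range k = {}" by auto
      then have "\<mu> j (P p - {k p}) + \<mu> j (range k) = \<mu> j ((P p - {k p}) \<union> range k)"
        by (rule add[symmetric])
      also have "\<dots> \<le> \<mu> j N" using PN[of p] PN k(1) by (intro mono) auto
      also have "\<dots> \<le> real (Suc n) * \<epsilon>" using PN[of p] k(1)[of p] by (intro Suc.prems(2)) (auto simp: j)
      finally show "\<mu> j (range k) \<le> real n * \<epsilon>" using k(2)[of p] by (simp add: j algebra_simps)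
    qed
    then obtain S where S: "S \<subseteq> range k" "infinite S" "\<forall>k\<in>S. \<mu> k (S - {k}) \<le> \<epsilon>"
      by (elim exE conjE)
    have "range k \<subseteq> N" using PN k(1) by blast
    with S show ?thesis by (intro exI[of _ S] conjI order_trans[of S "range k" N])
  qed
qed

lemma Rosenthal:
  assumes \<epsilon>: "\<epsilon> > 0"
  obtains S where "infinite S" "\<And>k. k \<in> S \<Longrightarrow> \<mu> k (S - {k}) \<le> \<epsilon>"
proof -
  obtain n :: nat where "M / \<epsilon> < real n" using reals_Archimedean2 by blast
  then have "M \<le> real n * \<epsilon>" using \<epsilon> by (simp add: field_simps)
  then have "\<mu> k UNIV \<le> real n * \<epsilon>" for k using bound[of k] by simp
  then show thesis using Rosenthal_within[OF \<epsilon>, of UNIV n] that by auto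
qed

end

lemma finitely_additive_family_variation:
  assumes "\<And>i. norm (\<phi> i) \<le> M"
  shows "finitely_additive_family (\<lambda>i A. variation (\<phi> i) (linfty_ind A)) M"
proof
  fix i A B
  show "0 \<le> variation (\<phi> i) (linfty_ind A)" by (rule variation_nonneg) simp
  show "variation (\<phi> i) (linfty_ind (A \<union> B)) =
      variation (\<phi> i) (linfty_ind A) + variation (\<phi> i) (linfty_ind B)" if "A \<inter> B = {}"
  proof -
    have "linfty_ind (A \<union> B) = linfty_ind A + linfty_ind B"
      using that by (intro bcontfun_eqI) (auto simp: indicator_def)
    then show ?thesis by (simp add: variation_add)
  qed
  have "norm (linfty_ind UNIV) \<le> 1" by (rule norm_linfty_leI) simp
  then have "norm (\<phi> i) * norm (linfty_ind UNIV) \<le> M * 1"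
    using assms[of i] order_trans[OF norm_ge_zero assms] by (intro mult_mono) auto
  then show "variation (\<phi> i) (linfty_ind UNIV) \<le> M"
    using variation_le_norm[of "linfty_ind UNIV" "\<phi> i"] by simp
qed

section \<open>Operators that fix a copy of the space of bounded sequences\<close>

lemma positive_functional_sum_variation:
  "positive_functional (\<lambda>u. \<Sum>i<n. variation (\<phi> i) u)"
  by unfold_locales
    (simp_all add: sum_nonneg variation_nonneg variation_add variation_scale sum.distrib sum_distrib_left)

text \<open>If control fails, it fails for the sum of the moduli of the functionals chosen so far.
  This yields \<open>x n\<close> in the unit ball with large image that these functionals hardly
  see; a norming functional of \<open>v (x n)\<close>, composed with \<open>v\<close>, is the next
  one. Disjointifying the sets where \<open>x n\<close> is not small produces disjointly supported
  \<open>b k\<close> with large images, and \<open>J\<close> spreads the unit vectors onto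
  them.\<close>

lemma spread_or_control:
  fixes v :: "linfty \<Rightarrow>\<^sub>L 'a::banach"
  assumes \<epsilon>: "\<epsilon> > 0"
  obtains (spread) J :: "linfty \<Rightarrow>\<^sub>L 'a" and \<delta> where "\<delta> > 0" "\<And>k. \<delta> \<le> norm (J (linfty_ind {k}))"
  | (control) N \<delta> where "positive_functional N" "\<delta> > 0"
      "\<And>x. \<lbrakk>norm x \<le> 1; \<epsilon> \<le> norm (v x)\<rbrakk> \<Longrightarrow> \<delta> \<le> N (linfty_abs x)"
proof (cases "\<exists>N \<delta>. positive_functional N \<and> \<delta> > 0 \<and>
    (\<forall>x. norm x \<le> 1 \<longrightarrow> \<epsilon> \<le> norm (v x) \<longrightarrow> \<delta> \<le> N (linfty_abs x))")
  case True
  then show thesis using control by blast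
next
  case False
  define M where "M = norm v"
  have M: "M \<ge> 0" by (simp add: M_def)
  \<comment> \<open>Discarding coordinates of size at most \<open>\<eta>\<close> costs at most
    \<open>\<eta> * M \<le> \<epsilon> / 2\<close>.\<close>
  define \<eta> where "\<eta> = \<epsilon> / (2 * (M + 1))"
  have \<eta>: "\<eta> > 0" using \<epsilon> M by (simp add: \<eta>_def)
  have \<eta>M: "\<eta> * M \<le> \<epsilon> / 2" using \<epsilon> M by (simp add: \<eta>_def field_simps)
  \<comment> \<open>The smallness that \<open>disjointify\<close> needs for mass
    \<open>\<epsilon> / 2\<close>, times \<open>\<eta>\<close> because
    \<open>\<bar>x n k\<bar>\<close> exceeds \<open>\<eta>\<close> on \<open>A n\<close>.\<close>
  define \<delta> where "\<delta> n = \<eta> * (\<epsilon> / 2 / 4 * (1/2) ^ (n + 1))" for n :: nat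
  have \<delta>: "\<delta> n > 0" for n using \<epsilon> \<eta> by (simp add: \<delta>_def)
  \<comment> \<open>Here \<open>r\<close> is the new pair of a vector and a functional, and
    \<open>f i\<close> with \<open>i < n\<close> are the earlier pairs.\<close>
  define P where "P f n r \<longleftrightarrow> norm (fst r) \<le> 1 \<and>
      (\<Sum>i<n. variation (snd (f i)) (linfty_abs (fst r))) \<le> \<delta> n \<and>
      \<epsilon> \<le> snd r (fst r) \<and> norm (snd r) \<le> M \<and> (\<forall>x. snd r x \<le> norm (v x))"
    for f :: "nat \<Rightarrow> linfty \<times> (linfty \<Rightarrow>\<^sub>L real)" and n :: nat and r :: "linfty \<times> (linfty \<Rightarrow>\<^sub>L real)"
  have "\<exists>f. \<forall>n. P f n (f n)"
  proof (rule dependent_wellorder_choice)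
    show "P f n r = P g n r" if "\<And>y. y < n \<Longrightarrow> f y = g y" for r f g n
      using that by (simp add: P_def)
    fix n :: nat and f :: "nat \<Rightarrow> linfty \<times> (linfty \<Rightarrow>\<^sub>L real)"
    have "\<not> (\<forall>x. norm x \<le> 1 \<longrightarrow> \<epsilon> \<le> norm (v x) \<longrightarrow>
        \<delta> n \<le> (\<Sum>i<n. variation (snd (f i)) (linfty_abs x)))"
      using False positive_functional_sum_variation[where n = n and \<phi> = "\<lambda>i. snd (f i)"] \<delta>[of n] by blast
    then obtain x where x: "norm x \<le> 1" "\<epsilon> \<le> norm (v x)"
      "(\<Sum>i<n. variation (snd (f i)) (linfty_abs x)) < \<delta> n" by auto
    obtain g :: "'a \<Rightarrow>\<^sub>L real" where g: "g (v x) = norm (v x)" "norm g \<le> 1"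
      by (rule norming_functional)
    have "norm (g o\<^sub>L v) \<le> norm g * norm v" by (rule norm_blinfun_compose)
    also have "\<dots> \<le> 1 * M" unfolding M_def by (intro mult_right_mono g(2) norm_ge_zero)
    finally have "norm (g o\<^sub>L v) \<le> M" by simp
    moreover have "g (v y) \<le> norm (v y)" for y
      using norm_blinfun[of g "v y"] mult_right_mono[OF g(2) norm_ge_zero[of "v y"]] by simp
    ultimately have "P f n (x, g o\<^sub>L v)" using x g(1) by (simp add: P_def)
    then show "\<exists>r. P f n r" ..
  qed
  then obtain f where f: "\<And>n. P f n (f n)" by blast
  define x where "x n = fst (f n)" for n
  define \<phi> where "\<phi> n = snd (f n)" for n
  have x1: "norm (x n) \<le> 1" for n using f[of n] by (simp add: P_def x_def)
  have small: "(\<Sum>i<n. variation (\<phi> i) (linfty_abs (x n))) \<le> \<delta> n" for n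
    using f[of n] by (simp add: P_def x_def \<phi>_def)
  have big: "\<epsilon> \<le> \<phi> n (x n)" for n using f[of n] by (simp add: P_def x_def \<phi>_def)
  have \<phi>M: "norm (\<phi> n) \<le> M" for n using f[of n] by (simp add: P_def \<phi>_def)
  have \<phi>v: "\<phi> n y \<le> norm (v y)" for n y using f[of n] by (simp add: P_def \<phi>_def)
  interpret finitely_additive_family "\<lambda>i A. variation (\<phi> i) (linfty_ind A)" M
    by (rule finitely_additive_family_variation[OF \<phi>M])
  interpret V: positive_functional "variation (\<phi> n)" for n
    by unfold_locales (simp_all add: variation_nonneg variation_add variation_scale)
  define A where "A n = {k. \<eta> < \<bar>x n k\<bar>}" for n
  have A_big: "\<epsilon> / 2 \<le> variation (\<phi> n) (linfty_ind (A n))" for n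
  proof -
    have "\<epsilon> \<le> variation (\<phi> n) (linfty_abs (x n))"
      using big[of n] variation_upper[of "x n" "linfty_abs (x n)" "\<phi> n"] by simp
    also have "\<dots> \<le> variation (\<phi> n) (linfty_ind (A n) + \<eta> *\<^sub>R linfty_ind UNIV)"
    proof (rule V.mono)
      fix k
      have "\<bar>x n k\<bar> \<le> 1" using linfty_abs_le_norm[of "x n" k] x1[of n] by simp
      then show "linfty_abs (x n) k \<le> (linfty_ind (A n) + \<eta> *\<^sub>R linfty_ind UNIV) k"
        using \<eta> by (auto simp: A_def indicator_def)
    qed simp
    also have "\<dots> = variation (\<phi> n) (linfty_ind (A n)) + \<eta> * variation (\<phi> n) (linfty_ind UNIV)"
      using \<eta> by (simp add: V.add V.scale)
    also have "\<dots> \<le> variation (\<phi> n) (linfty_ind (A n)) + \<epsilon> / 2"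
    proof -
      have "\<eta> * variation (\<phi> n) (linfty_ind UNIV) \<le> \<eta> * M"
        using \<eta> by (intro mult_left_mono bound) simp
      with \<eta>M show ?thesis by linarith
    qed
    finally show ?thesis by simp
  qed
  have A_small: "variation (\<phi> i) (linfty_ind (A n)) \<le> \<epsilon> / 2 / 4 * (1/2) ^ (n + 1)" if "i < n" for i n
  proof -
    have "\<eta> * variation (\<phi> i) (linfty_ind (A n)) = variation (\<phi> i) (\<eta> *\<^sub>R linfty_ind (A n))"
      using \<eta> by (simp add: V.scale)
    also have "\<dots> \<le> variation (\<phi> i) (linfty_abs (x n))"
      by (rule V.mono) (use \<eta> in \<open>auto simp: A_def indicator_def\<close>)
    also have "\<dots> \<le> (\<Sum>i<n. variation (\<phi> i) (linfty_abs (x n)))"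
      using that by (intro member_le_sum) (auto intro: V.nonneg)
    also have "\<dots> \<le> \<delta> n" by (rule small)
    finally show ?thesis using \<eta> unfolding \<delta>_def by simp
  qed
  obtain s U where U: "disjoint_family U"
    "\<And>k::nat. \<epsilon> / 2 / 2 \<le> variation (\<phi> (s k)) (linfty_ind (U k))"
  proof (rule disjointify[of "\<epsilon> / 2" A])
    show "\<epsilon> / 2 > 0" using \<epsilon> by simp
    show "\<epsilon> / 2 \<le> variation (\<phi> n) (linfty_ind (A n))" for n by (rule A_big)
    show "variation (\<phi> i) (linfty_ind (A n)) \<le> \<epsilon> / 2 / 4 * (1/2) ^ (n + 1)" if "i < n" for i n
      by (rule A_small[OF that])
  qed (rule that)
  \<comment> \<open>The modulus is at least \<open>\<epsilon> / 4\<close>; the smaller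
    \<open>\<epsilon> / 8\<close> gives the strict inequality needed to pick an element of the
    supremum.\<close>
  have "\<exists>b. (\<forall>n. \<bar>apply_bcontfun b n\<bar> \<le> indicator (U k) n) \<and> \<epsilon> / 8 < \<phi> (s k) b" for k
  proof -
    have "\<epsilon> / 8 < variation (\<phi> (s k)) (linfty_ind (U k))" using U(2)[of k] \<epsilon> by simp
    then show ?thesis by (rule variation_ex[rotated]) auto
  qed
  then obtain b where b: "\<And>k n. \<bar>apply_bcontfun (b k) n\<bar> \<le> indicator (U k) n"
    "\<And>k. \<epsilon> / 8 < \<phi> (s k) (b k)" by metis
  obtain W where W: "\<And>k. blinfun_apply W (linfty_ind {k}) = b k"
    using linfty_spread[OF U(1) b(1)] by metis
  show thesis
  proof (rule spread)
    show "\<epsilon> / 8 > 0" using \<epsilon> by simp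
    show "\<epsilon> / 8 \<le> norm ((v o\<^sub>L W) (linfty_ind {k}))" for k
      using b(2)[of k] \<phi>v[of "s k" "b k"] by (simp add: W)
  qed
qed

section \<open>Almost diagonal operators and complemented copies of \<open>linfty\<close>\<close>

lemma perturbed_identity_left_inverse:
  fixes R :: "'b::banach \<Rightarrow>\<^sub>L 'b"
  assumes R: "\<And>x. norm (R x - x) \<le> norm x / 2"
  obtains Q :: "'b \<Rightarrow>\<^sub>L 'b" where "\<And>x. Q (R x) = x"
proof -
  have ge: "norm x \<le> 2 * norm (R x)" for x
    using R[of x] norm_triangle_ineq4[of "R x" "R x - x"] by simp
  have surj: "\<exists>x. R x = y" for y
  proof -
    \<comment> \<open>A solution of \<open>R x = y\<close> is a fixed point of this map, which
      contracts by \<open>1/2\<close>.\<close>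
    have "\<exists>!x. y + (x - R x) = x"
    proof (rule banach_fix_type[of "1/2"])
      show "\<forall>x z. dist (y + (x - R x)) (y + (z - R z)) \<le> 1/2 * dist x z"
      proof (intro allI)
        fix x z
        have "(y + (x - R x)) - (y + (z - R z)) = - (R (x - z) - (x - z))"
          by (simp add: blinfun.diff_right)
        then have "dist (y + (x - R x)) (y + (z - R z)) = norm (R (x - z) - (x - z))"
          unfolding dist_norm by (metis norm_minus_cancel)
        then show "dist (y + (x - R x)) (y + (z - R z)) \<le> 1/2 * dist x z"
          using R[of "x - z"] by (simp add: dist_norm)
      qed
    qed auto
    then obtain x where "y + (x - R x) = x" by blast
    then have "R x = y" by (simp add: algebra_simps)
    then show ?thesis ..
  qed
  have inj: "inj (blinfun_apply R)"
  proof (rule injI)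
    fix x z assume "R x = R z"
    then show "x = z" using ge[of "x - z"] by (simp add: blinfun.diff_right)
  qed
  have inv: "R (inv (blinfun_apply R) y) = y" for y
    using surj by (intro f_inv_into_f) (metis rangeI)
  have "bounded_linear (inv (blinfun_apply R))"
  proof (rule bounded_linear_intro[of _ 2])
    show "inv (blinfun_apply R) (x + y) = inv (blinfun_apply R) x + inv (blinfun_apply R) y" for x y
      by (rule injD[OF inj]) (simp add: inv blinfun.add_right)
    show "inv (blinfun_apply R) (c *\<^sub>R x) = c *\<^sub>R inv (blinfun_apply R) x" for c x
      by (rule injD[OF inj]) (simp add: inv blinfun.scaleR_right)
    show "norm (inv (blinfun_apply R) x) \<le> norm x * 2" for x
      using ge[of "inv (blinfun_apply R) x"] by (simp add: inv)
  qed
  then show thesis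
    using inj by (intro that[of "Blinfun (inv (blinfun_apply R))"])
      (simp add: bounded_linear_Blinfun_apply)
qed

text \<open>The matrix \<open>f m (J (linfty_ind {n}))\<close> has diagonal 1, but nothing is known
  off the diagonal. Rosenthal's lemma gives an infinite \<open>S\<close> on which each functional
  has off-diagonal variation at most \<open>1/2\<close>, so compression to \<open>S\<close> is
  invertible. As \<open>r\<close> factors through coordinates taken from the \<open>f n\<close>, it
  kills their common kernel.\<close>

lemma spread_fixes_linfty:
  fixes J :: "linfty \<Rightarrow>\<^sub>L 'a::banach" and f :: "nat \<Rightarrow> 'a \<Rightarrow>\<^sub>L real"
  assumes f: "\<And>n. norm (f n) \<le> C" and one: "\<And>n. f n (J (linfty_ind {n})) = 1"
  obtains r :: "'a \<Rightarrow>\<^sub>L linfty" and w :: "linfty \<Rightarrow>\<^sub>L 'a"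
  where "\<And>x. r (w x) = x" "\<And>x. (\<And>n. f n x = 0) \<Longrightarrow> r x = 0"
proof -
  define \<phi> where "\<phi> n = f n o\<^sub>L J" for n
  have \<phi>: "norm (\<phi> n) \<le> C * norm J" for n
    unfolding \<phi>_def using norm_blinfun_compose[of "f n" J] mult_right_mono[OF f norm_ge_zero[of J]]
      order_trans by blast
  interpret finitely_additive_family "\<lambda>i A. variation (\<phi> i) (linfty_ind A)" "C * norm J"
    by (rule finitely_additive_family_variation[OF \<phi>])
  obtain S where S: "infinite S" "\<And>k. k \<in> S \<Longrightarrow> variation (\<phi> k) (linfty_ind (S - {k})) \<le> 1/2"
    using Rosenthal[of "1/2"] by auto
  define s where "s = enumerate S"
  have s: "inj s" "\<And>k. s k \<in> S" "range s = S"
    using S(1) strict_mono_enumerate[of S] range_enumerate[of S] strict_mono_imp_inj_on[of s UNIV]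
    by (auto simp: s_def enumerate_in_set)
  have disj: "disjoint_family (\<lambda>k. {s k})"
    using s(1) by (auto simp: disjoint_family_on_def inj_eq)
  have ind: "\<bar>linfty_ind {s k} n\<bar> \<le> indicator {s k} n" for k n by simp
  obtain W :: "linfty \<Rightarrow>\<^sub>L linfty" where
    W: "\<And>a k n. n \<in> {s k} \<Longrightarrow> W a n = a k * linfty_ind {s k} n"
      "\<And>a n. (\<And>k. n \<notin> {s k}) \<Longrightarrow> W a n = 0"
    using linfty_spread[OF disj ind] by metis
  obtain r :: "'a \<Rightarrow>\<^sub>L linfty" where r: "\<And>x n. r x n = f (s n) x"
    using linfty_operator[of "\<lambda>n. f (s n)" C] f by metis
  define w where "w = J o\<^sub>L W"
  have "norm (r (w x) - x) \<le> norm x / 2" for x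
  proof (rule norm_linfty_leI)
    fix k
    \<comment> \<open>The off-diagonal part of \<open>W x\<close>: without coordinate
      \<open>s k\<close> it lives on \<open>S - {s k}\<close>, where the variation is small.\<close>
    define y where "y = W x - x k *\<^sub>R linfty_ind {s k}"
    have y: "\<bar>y n\<bar> \<le> norm x * indicator (S - {s k}) n" for n
    proof (cases "n \<in> S")
      case True
      then obtain l where l: "n = s l" using s(3) by blast
      show ?thesis
        using s(1,2) linfty_abs_le_norm[of x l] by (auto simp: y_def W(1) l inj_eq indicator_def)
    next
      case False
      then have "\<And>k. n \<notin> {s k}" using s(3) by auto
      then show ?thesis using False s(2)[of k] by (auto simp: y_def W(2) indicator_def)
    qed
    have "\<phi> (s k) z \<le> norm x / 2" if "\<And>n. \<bar>apply_bcontfun z n\<bar> \<le> norm x * indicator (S - {s k}) n" for z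
    proof -
      have "\<phi> (s k) z \<le> variation (\<phi> (s k)) (norm x *\<^sub>R linfty_ind (S - {s k}))"
        by (rule variation_upper) (use that in simp)
      also have "\<dots> = norm x * variation (\<phi> (s k)) (linfty_ind (S - {s k}))"
        by (simp add: variation_scale)
      also have "\<dots> \<le> norm x * (1/2)" by (intro mult_left_mono S(2) s(2)) simp
      finally show ?thesis by simp
    qed
    from this[of y] this[of "- y"] have "\<bar>\<phi> (s k) y\<bar> \<le> norm x / 2"
      using y by (simp add: blinfun.minus_right abs_le_iff)
    moreover have "(r (w x) - x) k = \<phi> (s k) y"
      by (simp add: r w_def y_def \<phi>_def blinfun.diff_right blinfun.scaleR_right one)
    ultimately show "\<bar>apply_bcontfun (r (w x) - x) k\<bar> \<le> norm x / 2" by simp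
  qed
  then obtain Q :: "linfty \<Rightarrow>\<^sub>L linfty" where Q: "\<And>x. Q (r (w x)) = x"
    using perturbed_identity_left_inverse[of "r o\<^sub>L w"] by auto
  show thesis
  proof (rule that[of "Q o\<^sub>L r" w])
    show "(Q o\<^sub>L r) x = 0" if "\<And>n. f n x = 0" for x
    proof -
      have "r x = 0" by (rule bcontfun_eqI) (simp add: r that)
      then show ?thesis by simp
    qed
  qed (simp add: Q)
qed

section \<open>Copies of \<open>linfty\<close> away from a separable subspace\<close>

lemma uncountable_Pow_infinite:
  assumes "infinite (N :: nat set)" shows "uncountable (Pow N)"
proof
  assume "countable (Pow N)"
  have "inj (enumerate N)" using assms strict_mono_enumerate strict_mono_imp_inj_on by blast
  then have "inj (\<lambda>A. enumerate N ` A)" by (simp add: inj_def inj_image_eq_iff)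
  moreover have "range (\<lambda>A. enumerate N ` A) \<subseteq> Pow N"
    using assms by (auto simp: enumerate_in_set)
  ultimately have "countable (UNIV :: nat set set)"
    using countable_subset[OF _ \<open>countable (Pow N)\<close>]
      countable_image_inj_on[of "\<lambda>A. enumerate N ` A" UNIV] by simp
  then show False
    using countable_eqpoll[OF _ eqpoll_sym[OF nat_sets_eqpoll_reals]] uncountable_UNIV_real by simp
qed

text \<open>Images of distinct indicators are uniformly separated, so a countable set cannot come close
  to all of them.\<close>

lemma far_from_separable:
  fixes w :: "linfty \<Rightarrow>\<^sub>L 'a::banach" and r :: "'a \<Rightarrow>\<^sub>L linfty"
  assumes rw: "\<And>x. r (w x) = x" and D: "countable D" and N: "infinite N"
  obtains B where "B \<subseteq> N" "\<And>d. d \<in> closure D \<Longrightarrow> 1 / (2 * (norm r + 1)) \<le> dist (w (linfty_ind B)) d"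
proof -
  \<comment> \<open>The summand 1 makes \<open>norm r * (2 * \<delta>) < 1\<close> strict:
    indicators whose images are \<open>2 * \<delta>\<close>-close differ by less than 1 everywhere,
    hence coincide.\<close>
  define \<delta> where "\<delta> = 1 / (2 * (norm r + 1))"
  have \<delta>: "norm r * (2 * \<delta>) < 1"
  proof -
    have "2 * norm r + 2 > 0" using norm_ge_zero[of r] by linarith
    then show ?thesis by (auto simp: \<delta>_def divide_less_eq_1)
  qed
  have "\<exists>B\<subseteq>N. \<forall>d\<in>D. \<delta> \<le> dist (w (linfty_ind B)) d"
  proof (rule ccontr)
    assume "\<not> ?thesis"
    then have "\<forall>B\<in>Pow N. \<exists>d\<in>D. dist (w (linfty_ind B)) d < \<delta>" by (force simp: not_le)
    then obtain g where g: "\<And>B. B \<in> Pow N \<Longrightarrow> g B \<in> D"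
      "\<And>B. B \<in> Pow N \<Longrightarrow> dist (w (linfty_ind B)) (g B) < \<delta>" by metis
    have "inj_on g (Pow N)"
    proof (rule inj_onI)
      fix B C assume B: "B \<in> Pow N" and C: "C \<in> Pow N" and eq: "g B = g C"
      define x where "x = linfty_ind B - linfty_ind C"
      have "dist (w (linfty_ind B)) (w (linfty_ind C)) \<le> 2 * \<delta>"
        using g(2)[OF B] g(2)[OF C] eq dist_triangle2[of "w (linfty_ind B)" "w (linfty_ind C)" "g B"] by simp
      then have "norm (w x) \<le> 2 * \<delta>" by (simp add: dist_norm x_def blinfun.diff_right)
      then have "norm r * norm (w x) \<le> norm r * (2 * \<delta>)" by (intro mult_left_mono) auto
      then have "norm x < 1" using norm_blinfun[of r "w x"] \<delta> by (simp add: rw)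
      then have "\<bar>x n\<bar> < 1" for n using linfty_abs_le_norm[of x n] by simp
      then have lt: "\<bar>indicator B n - indicator C n :: real\<bar> < 1" for n by (simp add: x_def)
      show "B = C"
      proof (rule set_eqI)
        show "n \<in> B \<longleftrightarrow> n \<in> C" for n using lt[of n] by (auto simp: indicator_def split: if_splits)
      qed
    qed
    moreover have "g ` Pow N \<subseteq> D" using g(1) by blast
    ultimately have "countable (Pow N)"
      using countable_image_inj_on[of g "Pow N"] countable_subset[OF _ D] by simp
    then show False using uncountable_Pow_infinite[OF N] by blast
  qed
  then obtain B where B: "B \<subseteq> N" "\<And>d. d \<in> D \<Longrightarrow> \<delta> \<le> dist (w (linfty_ind B)) d" by blast
  have "closed {d. \<delta> \<le> dist (w (linfty_ind B)) d}"
    by (intro closed_Collect_le continuous_intros)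
  then have "closure D \<subseteq> {d. \<delta> \<le> dist (w (linfty_ind B)) d}"
    using B(2) by (intro closure_minimal) auto
  then show thesis using B(1) that by (auto simp: \<delta>_def)
qed

text \<open>\<open>spread_fixes_linfty\<close> is used twice: first for \<open>J\<close>, to get an
  embedding with a left inverse as \<open>far_from_separable\<close> requires, then for this
  embedding on disjoint indicators whose images are far from \<open>Y\<close>. The second set of
  functionals annihilates \<open>Y\<close>, and therefore so does \<open>r\<close>.\<close>

lemma linfty_complement_of_separable:
  fixes J :: "linfty \<Rightarrow>\<^sub>L 'a::banach"
  assumes \<delta>: "\<delta> > 0" and J: "\<And>k. \<delta> \<le> norm (J (linfty_ind {k}))"
    and Y: "subspace Y" "countable D" "Y \<subseteq> closure D"
  obtains r :: "'a \<Rightarrow>\<^sub>L linfty" and w :: "linfty \<Rightarrow>\<^sub>L 'a"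
  where "\<And>x. r (w x) = x" "\<And>y. y \<in> Y \<Longrightarrow> r y = 0"
proof -
  \<comment> \<open>With the subspace \<open>{0}\<close>, \<open>annihilating_functional\<close>
    gives a functional with value 1 and norm at most \<open>1 / \<delta>\<close>.\<close>
  have "\<exists>f. blinfun_apply f (J (linfty_ind {k})) = (1::real) \<and> norm f \<le> 1 / \<delta>" for k
  proof (rule annihilating_functional[OF subspace_single_0 \<delta>, of "J (linfty_ind {k})"])
    show "\<delta> \<le> dist (J (linfty_ind {k})) y" if "y \<in> {0}" for y
      using that J[of k] by simp
  qed (intro exI conjI)
  then obtain f :: "nat \<Rightarrow> 'a \<Rightarrow>\<^sub>L real" where f: "\<And>k. f k (J (linfty_ind {k})) = 1"
    "\<And>k. norm (f k) \<le> 1 / \<delta>" by metis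
  obtain r\<^sub>1 :: "'a \<Rightarrow>\<^sub>L linfty" and w\<^sub>1 :: "linfty \<Rightarrow>\<^sub>L 'a" where rw: "\<And>x. r\<^sub>1 (w\<^sub>1 x) = x"
    by (rule spread_fixes_linfty[OF f(2) f(1)]) (rule that)
  define \<epsilon> where "\<epsilon> = 1 / (2 * (norm r\<^sub>1 + 1))"
  have \<epsilon>: "\<epsilon> > 0" by (simp add: \<epsilon>_def add_nonneg_pos)
  define N where "N k = range (\<lambda>q. prod_encode (k, q))" for k :: nat
  have N: "infinite (N k)" for k
    unfolding N_def by (rule range_inj_infinite) (auto simp: inj_def)
  have "\<exists>B\<subseteq>N k. \<forall>d\<in>closure D. \<epsilon> \<le> dist (w\<^sub>1 (linfty_ind B)) d" for k
    using far_from_separable[OF rw Y(2) N[of k]] unfolding \<epsilon>_def by metis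
  then obtain B where B: "\<And>k. B k \<subseteq> N k"
    "\<And>k d. d \<in> closure D \<Longrightarrow> \<epsilon> \<le> dist (w\<^sub>1 (linfty_ind (B k))) d" by metis
  have "B k \<inter> B l = {}" if "k \<noteq> l" for k l
  proof -
    have "N k \<inter> N l = {}" using that by (auto simp: N_def)
    then show ?thesis using B(1)[of k] B(1)[of l] by blast
  qed
  then have disj: "disjoint_family B" by (simp add: disjoint_family_on_def)
  have ind: "\<bar>linfty_ind (B k) n\<bar> \<le> indicator (B k) n" for k n by simp
  obtain W :: "linfty \<Rightarrow>\<^sub>L linfty" where W: "\<And>k. W (linfty_ind {k}) = linfty_ind (B k)"
    by (rule linfty_spread[OF disj ind]) (rule that)
  have "\<exists>f :: 'a \<Rightarrow>\<^sub>L real. (\<forall>y\<in>Y. blinfun_apply f y = 0) \<and> blinfun_apply f (w\<^sub>1 (linfty_ind (B k))) = (1::real) \<and> norm f \<le> 1 / \<epsilon>" for k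
  proof (rule annihilating_functional[OF Y(1) \<epsilon>, of "w\<^sub>1 (linfty_ind (B k))"])
    show "\<epsilon> \<le> dist (w\<^sub>1 (linfty_ind (B k))) y" if "y \<in> Y" for y
      using B(2)[of y k] that Y(3) by blast
  qed (intro exI conjI ballI)
  then obtain g :: "nat \<Rightarrow> 'a \<Rightarrow>\<^sub>L real" where g: "\<And>k y. y \<in> Y \<Longrightarrow> g k y = 0"
    "\<And>k. g k (w\<^sub>1 (linfty_ind (B k))) = 1" "\<And>k. norm (g k) \<le> 1 / \<epsilon>" by metis
  note result = that
  show thesis
  proof (rule spread_fixes_linfty[of g "1 / \<epsilon>" "w\<^sub>1 o\<^sub>L W"])
    show "g k ((w\<^sub>1 o\<^sub>L W) (linfty_ind {k})) = 1" for k using g(2) by (simp add: W)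
    show thesis if "\<And>x. blinfun_apply r (blinfun_apply w x) = x"
      "\<And>x. (\<And>n. g n x = 0) \<Longrightarrow> blinfun_apply r x = 0"
    for r :: "'a \<Rightarrow>\<^sub>L linfty" and w :: "linfty \<Rightarrow>\<^sub>L 'a"
      by (rule result[of r w]) (simp_all add: that g(1))
  qed (rule g(3))
qed

section \<open>Saturated spaces are injective\<close>

lemma separable_top_of_setI:
  assumes "countable D" "D \<subseteq> Z" "Z \<subseteq> closure D"
  shows "separable_space (top_of_set Z)"
  unfolding separable_space_def
  using assms by (intro exI[of _ D]) (auto simp: closure_of_subtopology Int_absorb1)

lemma separable_top_of_setE:
  assumes "separable_space (top_of_set Z)"
  obtains D where "countable D" "D \<subseteq> Z" "Z \<subseteq> closure D"
proof -
  obtain D where D: "countable D" "D \<subseteq> Z" "top_of_set Z closure_of D = Z"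
    using assms by (auto simp: separable_space_def)
  have "Z \<subseteq> closure D"
    using D(3) closure_of_subtopology_subset[of euclidean Z D] by (simp add: closure_of_eq)
  with D show thesis by (intro that)
qed

text \<open>Real multiples are reached by two closure arguments, first in the scalar for fixed
  \<open>x\<close> in \<open>S\<close>, then in the vector for a fixed scalar. Countable sets of
  rational combinations thus have subspaces as closures.\<close>

lemma subspace_closure_rational:
  fixes S :: "'a::real_normed_vector set"
  assumes 0: "0 \<in> S" and add: "\<And>x y. \<lbrakk>x \<in> S; y \<in> S\<rbrakk> \<Longrightarrow> x + y \<in> S"
    and scale: "\<And>q x. \<lbrakk>q \<in> \<rat>; x \<in> S\<rbrakk> \<Longrightarrow> q *\<^sub>R x \<in> S"
  shows "subspace (closure S)"
proof (rule subspaceI)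
  show "0 \<in> closure S" using 0 closure_subset by blast
  show "x + y \<in> closure S" if xy: "x \<in> closure S" "y \<in> closure S" for x y
  proof -
    obtain f g where "\<And>n. f n \<in> S" "f \<longlonglongrightarrow> x" "\<And>n. g n \<in> S" "g \<longlonglongrightarrow> y"
      using xy by (auto simp: closure_sequential)
    then show ?thesis
      unfolding closure_sequential by (intro exI[of _ "\<lambda>n. f n + g n"]) (auto intro: add tendsto_add)
  qed
  show "c *\<^sub>R x \<in> closure S" if x: "x \<in> closure S" for c x
  proof -
    have "c *\<^sub>R x \<in> closure S" if "x \<in> S" for x
    proof -
      have "closed ((\<lambda>c. c *\<^sub>R x) -` closure S)"
        by (intro continuous_closed_vimage continuous_intros closed_closure)
      moreover have "\<rat> \<subseteq> (\<lambda>c. c *\<^sub>R x) -` closure S"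
        using scale that closure_subset by blast
      ultimately have "closure \<rat> \<subseteq> (\<lambda>c. c *\<^sub>R x) -` closure S" by (intro closure_minimal)
      then show ?thesis by (auto simp: Rats_closure_real)
    qed
    then have "S \<subseteq> (\<lambda>x. c *\<^sub>R x) -` closure S" by blast
    moreover have "closed ((\<lambda>x. c *\<^sub>R x) -` closure S)"
      by (intro continuous_closed_vimage continuous_intros closed_closure)
    ultimately have "closure S \<subseteq> (\<lambda>x. c *\<^sub>R x) -` closure S" by (intro closure_minimal)
    with x show ?thesis by blast
  qed
qed

text \<open>The inverse in \<open>isomorphic_to_linfty\<close> is only known to be continuous on
  \<open>Z\<close>; continuity at 0 and homogeneity give the norm bound.\<close>

lemma linear_bounded_of_continuous_on:
  fixes g :: "'a::real_normed_vector \<Rightarrow> 'b::real_normed_vector"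
  assumes Z: "subspace Z" and cont: "continuous_on Z g"
    and scale: "\<And>c z. z \<in> Z \<Longrightarrow> g (c *\<^sub>R z) = c *\<^sub>R g z"
  obtains K where "K \<ge> 0" "\<And>z. z \<in> Z \<Longrightarrow> norm (g z) \<le> K * norm z"
proof -
  have 0: "0 \<in> Z" by (rule subspace_0[OF Z])
  have g0: "g 0 = 0" using scale[OF 0, of 0] by simp
  obtain d where d: "d > 0" "\<And>z. \<lbrakk>z \<in> Z; norm z < d\<rbrakk> \<Longrightarrow> norm (g z) < 1"
    using cont 0 unfolding continuous_on_iff
    by (metis g0 dist_0_norm dist_commute zero_less_one)
  show thesis
  proof (rule that[of "2 / d"])
    fix z assume z: "z \<in> Z"
    show "norm (g z) \<le> 2 / d * norm z"
    proof (cases "z = 0")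
      case False
      have "norm (g ((d / (2 * norm z)) *\<^sub>R z)) < 1"
        using d(1) False by (intro d(2) subspace_scale[OF Z z]) simp
      then show ?thesis
        using d(1) False by (simp add: scale[OF z] field_simps)
    qed (simp add: g0)
  qed (use d(1) in simp)
qed

context normed_space
begin

text \<open>The coordinates are extended one at a time by Hahn-Banach with the same constant
  \<open>K\<close>, so the extensions again form bounded sequences.\<close>

lemma linfty_valued_extension:
  fixes h :: "'u \<Rightarrow> linfty"
  assumes Y: "Y \<subseteq> pts X" "vzero X \<in> Y" "\<And>x y. \<lbrakk>x \<in> Y; y \<in> Y\<rbrakk> \<Longrightarrow> vadd X x y \<in> Y"
      "\<And>c x. x \<in> Y \<Longrightarrow> vscale X c x \<in> Y"
    and h: "\<And>x y. \<lbrakk>x \<in> Y; y \<in> Y\<rbrakk> \<Longrightarrow> h (vadd X x y) = h x + h y"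
      "\<And>c x. x \<in> Y \<Longrightarrow> h (vscale X c x) = c *\<^sub>R h x"
      "\<And>x. x \<in> Y \<Longrightarrow> norm (h x) \<le> K * vnorm X x"
    and K: "K \<ge> 0"
  obtains H where "\<And>x y. \<lbrakk>x \<in> pts X; y \<in> pts X\<rbrakk> \<Longrightarrow> H (vadd X x y) = H x + H y"
    "\<And>c x. x \<in> pts X \<Longrightarrow> H (vscale X c x) = c *\<^sub>R H x"
    "\<And>x. x \<in> pts X \<Longrightarrow> norm (H x) \<le> K * vnorm X x" "\<And>x. x \<in> Y \<Longrightarrow> H x = h x"
proof -
  define P where "P n F \<longleftrightarrow> (\<forall>x\<in>pts X. \<forall>y\<in>pts X. F (vadd X x y) = F x + F y) \<and>
      (\<forall>c. \<forall>x\<in>pts X. F (vscale X c x) = c * F x) \<and>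
      (\<forall>x\<in>pts X. \<bar>F x\<bar> \<le> K * vnorm X x) \<and> (\<forall>x\<in>Y. F x = apply_bcontfun (h x) n)"
    for n and F :: "'u \<Rightarrow> real"
  have "\<exists>F. P n F" for n
  proof (rule Hahn_Banach_extension[OF Y, of "\<lambda>x. apply_bcontfun (h x) n" K])
    show "\<bar>apply_bcontfun (h x) n\<bar> \<le> K * vnorm X x" if "x \<in> Y" for x
      using h(3)[OF that] linfty_abs_le_norm[of "h x" n] by simp
    show "\<exists>F. P n F" if "\<And>x y. \<lbrakk>x \<in> pts X; y \<in> pts X\<rbrakk> \<Longrightarrow> F (vadd X x y) = F x + F y"
      "\<And>c x. x \<in> pts X \<Longrightarrow> F (vscale X c x) = c * F x"
      "\<And>x. x \<in> pts X \<Longrightarrow> \<bar>F x\<bar> \<le> K * vnorm X x" "\<And>x. x \<in> Y \<Longrightarrow> F x = apply_bcontfun (h x) n" for F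
      using that by (intro exI[of _ F]) (simp add: P_def)
  qed (simp_all add: h K)
  then obtain F where F: "\<And>n. P n (F n)" by metis
  define H where "H x = Bcontfun (\<lambda>n. F n x)" for x
  have H: "apply_bcontfun (H x) n = F n x" if "x \<in> pts X" for x n
    unfolding H_def
    by (subst Bcontfun_apply[of _ "K * vnorm X x"]) (use F that in \<open>simp_all add: P_def\<close>)
  show thesis
  proof (rule that[of H])
    show "H (vadd X x y) = H x + H y" if "x \<in> pts X" "y \<in> pts X" for x y
      by (rule bcontfun_eqI) (use F that add_in[OF that] in \<open>simp add: H P_def\<close>)
    show "H (vscale X c x) = c *\<^sub>R H x" if "x \<in> pts X" for c x
      by (rule bcontfun_eqI) (use F that scale_in[OF that] in \<open>simp add: H P_def\<close>)
    show "norm (H x) \<le> K * vnorm X x" if "x \<in> pts X" for x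
      by (rule norm_linfty_leI) (use F that in \<open>simp add: H P_def\<close>)
    show "H x = h x" if "x \<in> Y" for x
      by (rule bcontfun_eqI) (use F that Y(1) in \<open>auto simp: H P_def subset_iff\<close>)
  qed
qed

text \<open>The operator is Lipschitz for \<open>vnorm_dist\<close>, so it maps a countable dense
  set to a dense one.\<close>

lemma separable_closure_operator_image:
  fixes t :: "'u \<Rightarrow> 'b::real_normed_vector"
  assumes Y: "closed_subspace_of X Y" and sep: "separable_space (subtopology (vnorm_topology X) Y)"
    and add: "\<And>x y. \<lbrakk>x \<in> Y; y \<in> Y\<rbrakk> \<Longrightarrow> t (vadd X x y) = t x + t y"
    and scale: "\<And>c x. x \<in> Y \<Longrightarrow> t (vscale X c x) = c *\<^sub>R t x"
    and K: "\<And>x. x \<in> Y \<Longrightarrow> norm (t x) \<le> K * vnorm X x" "K > 0"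
  shows "separable_space (top_of_set (closure (t ` Y)))"
proof -
  interpret M: Metric_space "pts X" "vnorm_dist X" by (rule Metric_space_vnorm_dist)
  have YX: "Y \<subseteq> pts X"
    using Y closedin_subset[of M.mtopology Y] by (simp add: closed_subspace_of_def)
  have Ymem: "\<And>x y. \<lbrakk>x \<in> Y; y \<in> Y\<rbrakk> \<Longrightarrow> vadd X x y \<in> Y" "\<And>c x. x \<in> Y \<Longrightarrow> vscale X c x \<in> Y"
    using Y by (auto simp: closed_subspace_of_def)
  obtain C where C: "countable C" "C \<subseteq> Y" "subtopology M.mtopology Y closure_of C = Y"
    using sep YX by (auto simp: separable_space_def Int_absorb1)
  have YC: "Y \<subseteq> M.mtopology closure_of C"
    using C(3) closure_of_subtopology_subset[of M.mtopology Y C] by simp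
  have "t y \<in> closure (t ` C)" if y: "y \<in> Y" for y
    unfolding closure_approachable
  proof (intro allI impI)
    fix e :: real assume e: "e > 0"
    then have "e / K > 0" using K(2) by simp
    then obtain c where c: "c \<in> C" "c \<in> M.mball y (e / K)"
      using YC y unfolding M.metric_closure_of by blast
    have cY: "c \<in> Y" using c(1) C(2) by blast
    have "norm (t y - t c) = norm (t (vadd X y (vscale X (- 1) c)))"
      using add[OF y Ymem(2)[OF cY], of "- 1"] scale[OF cY, of "- 1"] by simp
    also have "\<dots> \<le> K * vnorm X (vadd X y (vscale X (- 1) c))"
      by (rule K(1)[OF Ymem(1)[OF y Ymem(2)[OF cY]]])
    also have "\<dots> = K * vnorm_dist X y c"
      using y cY YX by (auto simp: vnorm_dist_def)
    also have "\<dots> < e"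
      using c(2) K(2) by (simp add: M.in_mball field_simps)
    finally show "\<exists>z\<in>t ` C. dist z (t y) < e"
      using c(1) by (auto simp: dist_norm norm_minus_commute)
  qed
  then have "closure (t ` Y) \<subseteq> closure (t ` C)" by (intro closure_minimal) auto
  moreover have "t ` C \<subseteq> closure (t ` Y)" using C(2) closure_subset[of "t ` Y"] by blast
  ultimately show ?thesis using C(1) by (intro separable_top_of_setI[of "t ` C"]) auto
qed

end

theorem injective_if_linfty_upper_saturated:
  assumes sat: "linfty_upper_saturated TYPE('a::banach)"
  shows "universally_separably_injective TYPE('u) TYPE('a)"
  unfolding universally_separably_injective_def
proof (intro allI impI, elim conjE)
  fix X :: "'u normed_structure" and Y and t :: "'u \<Rightarrow> 'a"
  assume "banach_space X" and Y: "closed_subspace_of X Y"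
    and sep: "separable_space (subtopology (vnorm_topology X) Y)"
    and t: "bounded_operator_on X Y t"
  interpret banach_space X by fact
  interpret M: Metric_space "pts X" "vnorm_dist X" by (rule Metric_space_vnorm_dist)
  have YX: "Y \<subseteq> pts X"
    using Y closedin_subset[of M.mtopology Y] by (simp add: closed_subspace_of_def)
  have Ymem: "vzero X \<in> Y" "\<And>x y. \<lbrakk>x \<in> Y; y \<in> Y\<rbrakk> \<Longrightarrow> vadd X x y \<in> Y"
    "\<And>c x. x \<in> Y \<Longrightarrow> vscale X c x \<in> Y"
    using Y by (auto simp: closed_subspace_of_def)
  have t_add: "\<And>x y. \<lbrakk>x \<in> Y; y \<in> Y\<rbrakk> \<Longrightarrow> t (vadd X x y) = t x + t y"
    and t_scale: "\<And>c x. x \<in> Y \<Longrightarrow> t (vscale X c x) = c *\<^sub>R t x"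
    using t by (auto simp: bounded_operator_on_def)
  obtain K0 where "\<forall>x\<in>Y. norm (t x) \<le> K0 * vnorm X x"
    using t unfolding bounded_operator_on_def by blast
  then have K0: "\<And>x. x \<in> Y \<Longrightarrow> norm (t x) \<le> K0 * vnorm X x" by blast
  \<comment> \<open>\<open>K0\<close> may be zero, or negative when \<open>Y\<close> is trivial; a
    positive constant is needed later.\<close>
  define K where "K = \<bar>K0\<bar> + 1"
  have K: "K > 0" by (simp add: K_def)
  have t_le: "norm (t x) \<le> K * vnorm X x" if x: "x \<in> Y" for x
  proof -
    have "vnorm X x \<ge> 0" using x YX by (auto intro: vnorm_nonneg)
    then have "K0 * vnorm X x \<le> K * vnorm X x" by (intro mult_right_mono) (simp_all add: K_def)
    then show ?thesis using K0[OF x] by simp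
  qed
  have sub: "subspace (t ` Y)"
  proof (rule subspaceI)
    show "0 \<in> t ` Y"
      using t_scale[OF Ymem(1), of 0] Ymem(3)[OF Ymem(1), of 0] by (metis imageI scaleR_zero_left)
    show "a + b \<in> t ` Y" if "a \<in> t ` Y" "b \<in> t ` Y" for a b
      using that Ymem(2) t_add by (metis (no_types, lifting) image_iff)
    show "c *\<^sub>R a \<in> t ` Y" if "a \<in> t ` Y" for a c
      using that Ymem(3) t_scale by (metis (no_types, lifting) image_iff)
  qed
  have subspace_closure: "subspace (closure (t ` Y))"
    by (rule subspace_closure_rational)
      (use subspace_0[OF sub] subspace_add[OF sub] subspace_scale[OF sub] in auto)
  have "separable_space (top_of_set (closure (t ` Y)))"
    by (rule separable_closure_operator_image[OF Y sep t_add t_scale t_le K])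
  then obtain Z where Z: "subspace Z" "closure (t ` Y) \<subseteq> Z" "isomorphic_to_linfty Z"
    using sat subspace_closure unfolding linfty_upper_saturated_def by blast
  then obtain f :: "linfty \<Rightarrow> 'a" and g where f: "linear f" and fg: "homeomorphism UNIV Z f g"
    unfolding isomorphic_to_linfty_def by blast
  have gf: "g (f x) = x" for x using fg by (simp add: homeomorphism_def)
  have fg': "f (g z) = z" if "z \<in> Z" for z using fg that by (simp add: homeomorphism_def)
  have tZ: "t x \<in> Z" if "x \<in> Y" for x using Z(2) closure_subset that by blast
  \<comment> \<open>Linearity of the inverse is available on \<open>Z\<close> only; it comes from
    the linearity of \<open>f\<close>.\<close>
  have g_add: "g (a + b) = g a + g b" if "a \<in> Z" "b \<in> Z" for a b
    using gf[of "g a + g b"] that by (simp add: linear_add[OF f] fg')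
  have g_scale: "g (c *\<^sub>R a) = c *\<^sub>R g a" if "a \<in> Z" for a c
    using gf[of "c *\<^sub>R g a"] that by (simp add: linear_cmul[OF f] fg')
  have "continuous_on Z g" using fg by (simp add: homeomorphism_def)
  then obtain Kg where Kg: "Kg \<ge> 0" "\<And>z. z \<in> Z \<Longrightarrow> norm (g z) \<le> Kg * norm z"
    using linear_bounded_of_continuous_on[OF Z(1) _ g_scale] by metis
  have "continuous_on UNIV f" using fg by (simp add: homeomorphism_def)
  then obtain Kf where Kf: "Kf \<ge> 0" "\<And>x. norm (f x) \<le> Kf * norm x"
    using linear_bounded_of_continuous_on[of UNIV f] linear_cmul[OF f] by auto
  obtain H where H: "\<And>x y. \<lbrakk>x \<in> pts X; y \<in> pts X\<rbrakk> \<Longrightarrow> H (vadd X x y) = H x + H y"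
    "\<And>c x. x \<in> pts X \<Longrightarrow> H (vscale X c x) = c *\<^sub>R H x"
    "\<And>x. x \<in> pts X \<Longrightarrow> norm (H x) \<le> (Kg * K) * vnorm X x" "\<And>x. x \<in> Y \<Longrightarrow> H x = g (t x)"
  proof (rule linfty_valued_extension[OF YX Ymem, of "\<lambda>x. g (t x)" "Kg * K"])
    show "norm (g (t x)) \<le> Kg * K * vnorm X x" if "x \<in> Y" for x
      using Kg(2)[OF tZ[OF that]] mult_left_mono[OF t_le[OF that] Kg(1)] by simp
    show "g (t (vadd X x y)) = g (t x) + g (t y)" if "x \<in> Y" "y \<in> Y" for x y
      by (simp add: that t_add g_add tZ)
    show "g (t (vscale X c x)) = c *\<^sub>R g (t x)" if "x \<in> Y" for c x
      by (simp add: that t_scale g_scale tZ)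
    show "0 \<le> Kg * K" using Kg(1) K by simp
  qed ((assumption | rule that)+)
  show "\<exists>T. bounded_operator_on X (pts X) T \<and> (\<forall>y\<in>Y. T y = t y)"
  proof (intro exI[of _ "\<lambda>x. f (H x)"] conjI ballI)
    have "norm (f (H x)) \<le> Kf * (Kg * K) * vnorm X x" if "x \<in> pts X" for x
      using Kf(2)[of "H x"] mult_left_mono[OF H(3)[OF that] Kf(1)] by simp
    then show "bounded_operator_on X (pts X) (\<lambda>x. f (H x))"
      unfolding bounded_operator_on_def
      by (intro conjI exI[of _ "Kf * (Kg * K)"])
        (auto simp: H(1,2) linear_add[OF f] linear_cmul[OF f])
    show "f (H y) = t y" if "y \<in> Y" for y by (simp add: that H(4) fg' tZ)
  qed
qed

section \<open>Injective spaces are saturated\<close>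

text \<open>The copying map is an isometry onto its range, so it carries balls to balls. Closedness
  and separability of subspaces pass to the copy through it.\<close>

lemma homeomorphic_map_copy_along:
  fixes f :: "'x::banach \<Rightarrow> 'u"
  assumes f: "inj f"
  shows "homeomorphic_map euclidean (vnorm_topology (copy_along f)) f"
proof -
  let ?X = "copy_along f"
  interpret banach_space ?X by (rule banach_space_copy_along[OF f])
  interpret M: Metric_space "pts ?X" "vnorm_dist ?X" by (rule Metric_space_vnorm_dist)
  have p: "pts ?X = range f" by (simp add: copy_along_def)
  have d: "vnorm_dist ?X (f x) (f y) = dist x y" for x y
    using f by (simp add: vnorm_dist_def copy_along_def dist_norm)
  have ball: "M.mball (f x) r = f ` ball x r" for x r
  proof -
    have "M.mball (f x) r = {y \<in> range f. vnorm_dist ?X (f x) y < r}"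
      unfolding M.mball_def unfolding p by auto
    also have "\<dots> = f ` ball x r" by (auto simp: d)
    finally show ?thesis .
  qed
  have op: "openin M.mtopology (f ` U) \<longleftrightarrow> open U" for U
  proof -
    have "openin M.mtopology (f ` U) \<longleftrightarrow> (\<forall>x\<in>U. \<exists>r>0. f ` ball x r \<subseteq> f ` U)"
      unfolding M.openin_mtopology by (auto simp flip: ball) (auto simp: p)
    then show ?thesis
      unfolding open_contains_ball inj_image_subset_iff[OF f] .
  qed
  have top: "topspace M.mtopology = range f"
    using M.topspace_mtopology p by (rule trans)
  have "continuous_map euclidean M.mtopology f"
    unfolding continuous_map_def
  proof (intro conjI allI impI)
    fix U assume U: "openin M.mtopology U"
    have "U \<subseteq> range f" using openin_subset[OF U] unfolding top .
    then have "U = f ` (f -` U)" by auto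
    then show "openin euclidean {x \<in> topspace euclidean. f x \<in> U}"
      using U op[of "f -` U"] by (simp add: vimage_def)
  qed (simp, simp add: p)
  moreover have "open_map euclidean M.mtopology f"
    by (simp add: open_map_def op)
  ultimately show ?thesis
    using f by (intro bijective_open_imp_homeomorphic_map) (simp_all, simp add: p)
qed

text \<open>The coordinates of \<open>i\<close> are norming functionals of a sequence dense in
  \<open>Y\<close>. The inequality holds on that sequence and is a closed condition.\<close>

lemma separable_norming_operator:
  fixes Y :: "'a::banach set"
  assumes D: "countable D" "D \<noteq> {}" "Y \<subseteq> closure D"
  obtains i :: "'a \<Rightarrow>\<^sub>L linfty" where "\<And>y. y \<in> Y \<Longrightarrow> norm y \<le> norm (i y)"
proof -
  obtain d :: "nat \<Rightarrow> 'a" where d: "D = range d"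
    using D(1,2) by (metis uncountable_def)
  have "\<exists>g. blinfun_apply g (d n) = norm (d n) \<and> norm g \<le> 1" for n
    by (rule norming_functional[of "d n"]) (intro exI conjI)
  then obtain g :: "nat \<Rightarrow> 'a \<Rightarrow>\<^sub>L real" where g: "\<And>n. g n (d n) = norm (d n)" "\<And>n. norm (g n) \<le> 1"
    by metis
  obtain i :: "'a \<Rightarrow>\<^sub>L linfty" where i: "\<And>x n. i x n = g n x"
    by (rule linfty_operator[OF g(2)]) (rule that)
  have "D \<subseteq> {y. norm y \<le> norm (i y)}"
  proof -
    have "norm (d n) \<le> norm (i (d n))" for n
      using linfty_abs_le_norm[of "i (d n)" n] by (simp add: i g(1))
    then show ?thesis by (auto simp: d)
  qed
  moreover have "closed {y. norm y \<le> norm (i y)}"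
    by (intro closed_Collect_le continuous_intros)
  ultimately have "closure D \<subseteq> {y. norm y \<le> norm (i y)}" by (intro closure_minimal)
  then show thesis using D(3) by (intro that[of i]) auto
qed

text \<open>The test spaces are carried by subsets of \<open>'a + 'u\<close>. A nonzero vector makes
  \<open>'a\<close> large enough for a copy of \<open>linfty\<close>, and injectivity is applied to
  this copy.\<close>

lemma injective_extension_linfty:
  fixes t :: "linfty \<Rightarrow> 'a::banach" and a :: 'a
  assumes inj: "universally_separably_injective TYPE('a + 'u) TYPE('a)" and a: "a \<noteq> 0"
    and W: "subspace W" "closed W" "separable_space (top_of_set W)"
    and add: "\<And>x y. \<lbrakk>x \<in> W; y \<in> W\<rbrakk> \<Longrightarrow> t (x + y) = t x + t y"
    and scale: "\<And>c x. x \<in> W \<Longrightarrow> t (c *\<^sub>R x) = c *\<^sub>R t x"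
    and K: "\<And>x. x \<in> W \<Longrightarrow> norm (t x) \<le> K * norm x"
  obtains v :: "linfty \<Rightarrow>\<^sub>L 'a" where "\<And>x. x \<in> W \<Longrightarrow> v x = t x"
proof -
  obtain h\<^sub>0 :: "linfty \<Rightarrow> 'a" where "inj h\<^sub>0" by (rule inj_linfty[OF a])
  define h :: "linfty \<Rightarrow> 'a + 'u" where "h x = Inl (h\<^sub>0 x)" for x
  have h: "inj h" using \<open>inj h\<^sub>0\<close> by (auto simp: h_def inj_def)
  let ?X = "copy_along h"
  have X: "pts ?X = range h" "vzero ?X = h 0" "\<And>x y. vadd ?X (h x) (h y) = h (x + y)"
    "\<And>c x. vscale ?X c (h x) = h (c *\<^sub>R x)" "\<And>x. vnorm ?X (h x) = norm x"
    using h by (simp_all add: copy_along_def)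
  have hom: "homeomorphic_map euclidean (vnorm_topology ?X) h"
    by (rule homeomorphic_map_copy_along[OF h])
  have top: "topspace (vnorm_topology ?X) = range h"
    using homeomorphic_imp_surjective_map[OF hom] by simp
  have "closedin (vnorm_topology ?X) (h ` W)"
    using homeomorphic_map_closedness[OF hom, of W] W(2) by simp
  then have sub: "closed_subspace_of ?X (h ` W)"
    unfolding closed_subspace_of_def
    using subspace_0[OF W(1)] subspace_add[OF W(1)] subspace_scale[OF W(1)] by (auto simp: X)
  have "continuous_map (top_of_set W) (subtopology (vnorm_topology ?X) (h ` W)) h"
    using homeomorphic_imp_continuous_map[OF hom]
    by (intro continuous_map_into_subtopology continuous_map_from_subtopology) auto
  moreover have "h ` topspace (top_of_set W) = topspace (subtopology (vnorm_topology ?X) (h ` W))"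
    unfolding topspace_subtopology top by auto
  ultimately have sep: "separable_space (subtopology (vnorm_topology ?X) (h ` W))"
    by (rule separable_space_continuous_map_image[OF W(3)])
  define s where "s u = t (inv h u)" for u
  have s: "s (h x) = t x" for x using h by (simp add: s_def)
  have "bounded_operator_on ?X (h ` W) s"
    unfolding bounded_operator_on_def
    using add scale K by (auto simp: X s intro!: exI[of _ K])
  then obtain T where T: "bounded_operator_on ?X (pts ?X) T" "\<forall>y\<in>h ` W. T y = s y"
    using inj banach_space_copy_along[OF h] sub sep
    unfolding universally_separably_injective_def by blast
  obtain L where "\<forall>u\<in>pts ?X. norm (T u) \<le> L * vnorm ?X u"
    using T(1) unfolding bounded_operator_on_def by blast
  then have L: "norm (T (h x)) \<le> norm x * L" for x by (simp add: X mult.commute)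
  have T_add: "T (h (x + y)) = T (h x) + T (h y)" for x y
    using T(1) unfolding bounded_operator_on_def by (metis X(1,3) rangeI)
  have T_scale: "T (h (c *\<^sub>R x)) = c *\<^sub>R T (h x)" for c x
    using T(1) unfolding bounded_operator_on_def by (metis X(1,4) rangeI)
  have "bounded_linear (\<lambda>x. T (h x))"
    using T_add T_scale L by (rule bounded_linear_intro)
  then show thesis
    using T(2) by (intro that[of "Blinfun (\<lambda>x. T (h x))"]) (simp add: bounded_linear_Blinfun_apply s)
qed

text \<open>The operator \<open>i\<close> is bounded below on \<open>Y\<close>, so its image is
  closed and separable, and the inverse on that image extends to all of
  \<open>linfty\<close>.\<close>

lemma injective_retraction:
  fixes Y :: "'a::banach set" and a :: 'a
  assumes inj: "universally_separably_injective TYPE('a + 'u) TYPE('a)" and a: "a \<noteq> 0"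
    and Y: "subspace Y" "closed Y" and D: "countable D" "D \<subseteq> Y" "Y \<subseteq> closure D"
  obtains i :: "'a \<Rightarrow>\<^sub>L linfty" and v :: "linfty \<Rightarrow>\<^sub>L 'a" where "\<And>y. y \<in> Y \<Longrightarrow> v (i y) = y"
proof -
  have "D \<noteq> {}" using D(3) subspace_0[OF Y(1)] by auto
  then obtain i :: "'a \<Rightarrow>\<^sub>L linfty" where i: "\<And>y. y \<in> Y \<Longrightarrow> norm y \<le> norm (i y)"
    using separable_norming_operator[OF D(1) _ D(3)] by metis
  have inj_i: "inj_on (blinfun_apply i) Y"
  proof (rule inj_onI)
    fix x y assume "x \<in> Y" "y \<in> Y" "i x = i y"
    then show "x = y" using i[of "x - y"] subspace_diff[OF Y(1)] by (simp add: blinfun.diff_right)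
  qed
  define W where "W = blinfun_apply i ` Y"
  have lin: "linear (blinfun_apply i)" by (simp add: blinfun.bounded_linear_right bounded_linear.linear)
  have W: "subspace W" unfolding W_def by (rule linear_subspace_image[OF lin Y(1)])
  have "complete W"
    unfolding W_def
    by (rule complete_isometric_image[of 1])
      (use i Y in \<open>simp_all add: complete_eq_closed blinfun.bounded_linear_right\<close>)
  then have W_closed: "closed W" by (rule complete_imp_closed)
  have "W \<subseteq> closure (blinfun_apply i ` D)"
    unfolding W_def
    using D(3) closure_bounded_linear_image_subset[of "blinfun_apply i" D] blinfun.bounded_linear_right
    by blast
  then have W_sep: "separable_space (top_of_set W)"
    using D(1,2) by (intro separable_top_of_setI[of "blinfun_apply i ` D"]) (auto simp: W_def)
  define t where "t = inv_into Y (blinfun_apply i)"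
  have t: "t (i y) = y" if "y \<in> Y" for y
    unfolding t_def using inj_i that by simp
  obtain v :: "linfty \<Rightarrow>\<^sub>L 'a" where v: "\<And>x. x \<in> W \<Longrightarrow> v x = t x"
  proof (rule injective_extension_linfty[OF inj a W W_closed W_sep, of t 1])
    show "t (x + y) = t x + t y" if "x \<in> W" "y \<in> W" for x y
      using that subspace_add[OF Y(1)] by (auto simp: W_def t simp flip: blinfun.add_right)
    show "t (c *\<^sub>R x) = c *\<^sub>R t x" if "x \<in> W" for c x
      using that subspace_scale[OF Y(1)] by (auto simp: W_def t simp flip: blinfun.scaleR_right)
    show "norm (t x) \<le> 1 * norm x" if "x \<in> W" for x
      using that i by (auto simp: W_def t)
  qed (rule that)
  show thesis by (rule that[of v i]) (simp add: v t W_def)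
qed

lemma infinite_independent_sequence:
  assumes "infinite_dimensional TYPE('a::real_vector)"
  obtains b :: "nat \<Rightarrow> 'a::real_vector" where "inj b" "independent (range b)"
proof -
  obtain B :: "'a set" where B: "independent B" "UNIV \<subseteq> span B"
    using basis_exists[of UNIV] by metis
  then have "infinite B" using assms by (auto simp: infinite_dimensional_def)
  then obtain b :: "nat \<Rightarrow> 'a" where "inj b" "range b \<subseteq> B"
    using infinite_countable_subset by blast
  then show thesis using independent_mono[OF B(1)] that by blast
qed

text \<open>Apply \<open>spread_or_control\<close> to the \<open>v\<close> of a separable
  \<open>Y\<close> that contains an independent sequence. Control would make \<open>i\<close> map
  \<open>Y\<close> into a finite-dimensional space, although \<open>v\<close> recovers the sequence
  from there.\<close>

lemma injective_has_spread:
  assumes dim: "infinite_dimensional TYPE('a::banach)"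
    and inj: "universally_separably_injective TYPE('a::banach + 'u) TYPE('a)"
  obtains J :: "linfty \<Rightarrow>\<^sub>L 'a::banach" and \<delta> where "\<delta> > 0" "\<And>k. \<delta> \<le> norm (J (linfty_ind {k}))"
proof -
  obtain b :: "nat \<Rightarrow> 'a" where b: "inj b" "independent (range b)"
    by (rule infinite_independent_sequence[OF dim])
  have "b 0 \<noteq> 0" using b(2) dependent_zero by (metis rangeI)
  \<comment> \<open>Lists of rational coefficients with indices form a countable type, so the range
    is a countable dense subset of \<open>Y\<close>.\<close>
  define comb where "comb l = (\<Sum>(q, n)\<leftarrow>l. of_rat q *\<^sub>R b n)" for l :: "(rat \<times> nat) list"
  define Y where "Y = closure (range comb)"
  have Y: "subspace Y"
    unfolding Y_def
  proof (rule subspace_closure_rational)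
    show "0 \<in> range comb" by (rule image_eqI[of _ _ "[]"]) (simp_all add: comb_def)
    show "x + y \<in> range comb" if "x \<in> range comb" "y \<in> range comb" for x y
    proof -
      obtain l m where "x = comb l" "y = comb m" using \<open>x \<in> range comb\<close> \<open>y \<in> range comb\<close> by blast
      then have "x + y = comb (l @ m)" by (simp add: comb_def)
      then show ?thesis by blast
    qed
    show "q *\<^sub>R x \<in> range comb" if qx: "q \<in> \<rat>" "x \<in> range comb" for q x
    proof -
      obtain p l where pl: "q = of_rat p" "x = comb l" using qx by (auto simp: Rats_def)
      have "of_rat p *\<^sub>R comb l = comb (map (\<lambda>(q, n). (p * q, n)) l)"
        by (induction l) (auto simp: comb_def scaleR_right_distrib of_rat_mult)
      then show ?thesis using pl by blast
    qed
  qed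
  have bY: "b n \<in> Y" for n
  proof -
    have "b n = comb [(1, n)]" by (simp add: comb_def)
    then have "b n \<in> range comb" by (rule range_eqI)
    then show ?thesis unfolding Y_def by (rule subsetD[OF closure_subset])
  qed
  obtain i :: "'a \<Rightarrow>\<^sub>L linfty" and v :: "linfty \<Rightarrow>\<^sub>L 'a" where iv: "\<And>y. y \<in> Y \<Longrightarrow> v (i y) = y"
  proof (rule injective_retraction[OF inj \<open>b 0 \<noteq> 0\<close> Y, of "range comb"])
    show "range comb \<subseteq> Y" "Y \<subseteq> closure (range comb)" "closed Y"
      using closure_subset by (simp_all add: Y_def)
  qed (simp, rule that)
  \<comment> \<open>A unit vector \<open>i y\<close> with \<open>y\<close> in \<open>Y\<close>
    satisfies \<open>norm y \<ge> \<epsilon>\<close>, and \<open>v\<close> maps it to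
    \<open>y\<close>; so control applies to all of them.\<close>
  define \<epsilon> where "\<epsilon> = 1 / (norm i + 1)"
  have i1: "norm i + 1 > 0" using norm_ge_zero[of i] by linarith
  have \<epsilon>: "\<epsilon> > 0" using i1 by (simp add: \<epsilon>_def)
  show thesis
  proof (rule spread_or_control[OF \<epsilon>, where v = v])
    fix N \<delta> assume N: "positive_functional N" and \<delta>: "\<delta> > 0"
      and ctrl: "\<And>x. \<lbrakk>norm x \<le> 1; \<epsilon> \<le> norm (v x)\<rbrakk> \<Longrightarrow> \<delta> \<le> N (linfty_abs x)"
    interpret positive_functional N by fact
    define W where "W = blinfun_apply i ` Y"
    have lin: "linear (blinfun_apply A)" for A :: "'x::real_normed_vector \<Rightarrow>\<^sub>L 'y::real_normed_vector"
      by (simp add: blinfun.bounded_linear_right bounded_linear.linear)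
    have W: "subspace W" unfolding W_def by (rule linear_subspace_image[OF lin Y])
    have W_le: "norm x \<le> (1 / \<delta>) * N (linfty_abs x)" if "x \<in> W" for x
    proof (cases "x = 0")
      case True
      then show ?thesis using nonneg[of "linfty_abs x"] \<delta> by simp
    next
      case False
      obtain y where y: "y \<in> Y" "x = i y" using \<open>x \<in> W\<close> by (auto simp: W_def)
      have "norm x \<le> norm i * norm y" using norm_blinfun[of i y] y(2) by simp
      also have "\<dots> \<le> (norm i + 1) * norm y" by (simp add: distrib_right)
      finally have "\<epsilon> \<le> norm y / norm x"
        using False i1 by (simp add: \<epsilon>_def field_simps)
      then have "\<epsilon> \<le> norm (v ((1 / norm x) *\<^sub>R x))"
        using iv[OF y(1)] y(2) by (simp add: blinfun.scaleR_right)
      then have "\<delta> \<le> N (linfty_abs ((1 / norm x) *\<^sub>R x))"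
        using False by (intro ctrl) simp_all
      also have "linfty_abs ((1 / norm x) *\<^sub>R x) = (1 / norm x) *\<^sub>R linfty_abs x"
        by (rule bcontfun_eqI) (simp add: abs_mult)
      also have "N \<dots> = (1 / norm x) * N (linfty_abs x)" by (rule scale) auto
      finally show ?thesis using False \<delta> by (simp add: field_simps)
    qed
    obtain B where B: "finite B" "W \<subseteq> span B"
    proof (rule finite_dim_of_norm_le[OF W W_le])
      show "0 \<le> 1 / \<delta>" using \<delta> by simp
    qed (assumption, rule that)
    have "range b \<subseteq> span (blinfun_apply v ` B)"
    proof -
      have "b n \<in> blinfun_apply v ` span B" for n
        using B(2) bY[of n] iv[OF bY[of n]] by (force simp: W_def intro: image_eqI[of _ _ "i (b n)"])
      then show ?thesis by (auto simp: linear_span_image[OF lin])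
    qed
    then have "finite (range b)"
      using independent_span_bound[OF _ b(2), of "blinfun_apply v ` B"] B(1) by simp
    then show thesis using range_inj_infinite[OF b(1)] by simp
  qed (rule that)
qed

theorem linfty_upper_saturated_if_injective:
  assumes dim: "infinite_dimensional TYPE('a::banach)"
    and inj: "universally_separably_injective TYPE('a::banach + 'u) TYPE('a)"
  shows "linfty_upper_saturated TYPE('a::banach)"
  unfolding linfty_upper_saturated_def
proof (intro allI impI, elim conjE)
  fix Y :: "'a set" assume Y: "subspace Y" "closed Y" and sep: "separable_space (top_of_set Y)"
  obtain D where D: "countable D" "D \<subseteq> Y" "Y \<subseteq> closure D"
    by (rule separable_top_of_setE[OF sep])
  \<comment> \<open>Only a nonzero vector is wanted here, for the copy of \<open>linfty\<close> in
    \<open>'a + 'u\<close>.\<close>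
  obtain b :: "nat \<Rightarrow> 'a" where "independent (range b)"
    using infinite_independent_sequence[OF dim] by metis
  then have "b 0 \<noteq> 0" using dependent_zero by (metis rangeI)
  obtain i :: "'a \<Rightarrow>\<^sub>L linfty" and v :: "linfty \<Rightarrow>\<^sub>L 'a" where iv: "\<And>y. y \<in> Y \<Longrightarrow> v (i y) = y"
    by (rule injective_retraction[OF inj \<open>b 0 \<noteq> 0\<close> Y D]) (rule that)
  obtain J :: "linfty \<Rightarrow>\<^sub>L 'a" and \<delta> where J: "\<delta> > 0" "\<And>k. \<delta> \<le> norm (J (linfty_ind {k}))"
    by (rule injective_has_spread[OF dim inj]) (rule that)
  obtain r :: "'a \<Rightarrow>\<^sub>L linfty" and w :: "linfty \<Rightarrow>\<^sub>L 'a"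
    where rw: "\<And>x. r (w x) = x" and rY: "\<And>y. y \<in> Y \<Longrightarrow> r y = 0"
    by (rule linfty_complement_of_separable[OF J Y(1) D(1,3)]) (rule that)
  \<comment> \<open>Projecting along the range of \<open>w\<close> gives \<open>r u = 0\<close> and
    keeps \<open>u (i y) = y\<close> on \<open>Y\<close>, because \<open>r\<close> vanishes
    there.\<close>
  define u where "u = v - (w o\<^sub>L r o\<^sub>L v)"
  define T where "T = u + (w o\<^sub>L (id_blinfun - (i o\<^sub>L u)))"
  define S where "S = r + (i o\<^sub>L (id_blinfun - (w o\<^sub>L r)))"
  have u: "u x = v x - w (r (v x))" for x by (simp add: u_def blinfun.diff_left)
  have T: "T x = u x + w (x - i (u x))" for x
    by (simp add: T_def blinfun.add_left blinfun.diff_left)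
  have S: "S z = r z + i (z - w (r z))" for z
    by (simp add: S_def blinfun.add_left blinfun.diff_left)
  have ru: "r (u x) = 0" for x by (simp add: u blinfun.diff_right rw)
  have rT: "r (T x) = x - i (u x)" for x by (simp add: T blinfun.add_right ru rw)
  \<comment> \<open>By \<open>rT\<close>, \<open>r\<close> reads off \<open>x - i (u x)\<close>.
    Subtracting the \<open>w\<close> part from \<open>T x\<close> leaves \<open>u x\<close>, and
    \<open>i\<close> restores the missing term.\<close>
  have ST: "S (T x) = x" for x by (simp add: S rT) (simp add: T)
  have TY: "T (i y) = y" if "y \<in> Y" for y
    by (simp add: T u iv[OF that] rY[OF that])
  define Z where "Z = range (blinfun_apply T)"
  have lin: "linear (blinfun_apply T)"
    by (simp add: blinfun.bounded_linear_right bounded_linear.linear)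
  \<comment> \<open>The range of an operator with a continuous left inverse is the fixed-point set
    of a continuous map, hence closed.\<close>
  have "Z = {z. T (S z) = z}" using ST by (auto simp: Z_def) (metis rangeI)
  then have "closed Z" by (simp add: closed_Collect_eq continuous_intros)
  moreover have "subspace Z" unfolding Z_def by (rule linear_subspace_image[OF lin subspace_UNIV])
  moreover have "Y \<subseteq> Z" using TY unfolding Z_def by (metis rangeI subsetI)
  moreover have "homeomorphism UNIV Z (blinfun_apply T) (blinfun_apply S)"
    unfolding homeomorphism_def Z_def using ST
    by (auto intro!: continuous_intros simp: image_iff)
  then have "isomorphic_to_linfty Z" using lin unfolding isomorphic_to_linfty_def by blast
  ultimately show "\<exists>Z. subspace Z \<and> closed Z \<and> Y \<subseteq> Z \<and> isomorphic_to_linfty Z" by blast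
qed

theorem theorem5p1:
  assumes "infinite_dimensional TYPE('a::banach)"
  shows "universally_separably_injective TYPE('a + 'u) TYPE('a)
           \<longleftrightarrow> linfty_upper_saturated TYPE('a)"
  using linfty_upper_saturated_if_injective[OF assms] injective_if_linfty_upper_saturated
  by (rule iffI)

end
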